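(* Let $c>0$, let $\mathcal{E}=\{\mathcal{T}^1,\dots,\mathcal{T}^m\}$ be an ensemble of $m$ tree partitions of $[0,1]^p$, let $s=(1+mc)^{-1/2}$, and let $A$ be a finite nonempty set of realization indices with covariate values $x_i\in[0,1]^p$, $i\in A$. Let $F_Y$ be a distribution function on $\mathbb{R}$ with density $p_Y(y)=\frac{d}{dy}F_Y(y)$ and quantile function $F_Y^{-1}$, let $\Phi,\phi$ be the standard normal distribution function and density, and let the random vectors $\widetilde Z_A$, $Y_A$ and $\mathcal{M}$ be as in the context. Consider the element-wise map $R$ given by $$y_A=R(\tilde z_A),\qquad y_i=F_Y^{-1}\big(\Phi(s\tilde z_i)\big),\quad i\in A .$$ Then the determinant of the Jacobian of $R$ is $$\det(J_R):=\left|\frac{dy_A}{d\tilde z_A}\right|=\prod_{i\in A}\frac{s\,\phi(z_i)}{p_Y(y_i)},\qquad z_i=s\tilde z_i$$ (at points where $p_Y(y_i)>0$ for all $i\in A$). Moreover, writing $\mathbb{P}_X$ for the law of a random vector $X$: (i) $R$ pushes $\mathbb{P}_{\widetilde Z_A\mid c,\mathcal{E}}$ forward to $\mathbb{P}_{Y_A\mid c,\mathcal{E}}$, and $R$ is the optimal transport map between these two laws under quadratic loss, i.e. $R$ minimizes $\int\|\tilde z-T(\tilde z)\|_2^2\,d\mathbb{P}_{\widetilde Z_A\mid c,\mathcal{E}}(\tilde z)$ over all measurable maps $T$ that push $\mathbb{P}_{\widetilde Z_A\mid c,\mathcal{E}}$ forward to $\mathbb{P}_{Y_A\mid c,\mathcal{E}}$;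 (ii) $R$ pushes $\mathbb{P}_{\widetilde Z_A\mid c,\mathcal{E},\mathcal{M}}$ forward to $\mathbb{P}_{Y_A\mid c,\mathcal{E},\mathcal{M}}$.
   Context: Tree ensemble. Each $\mathcal{T}^j=\{T^j_1,\dots,T^j_{K^j}\}$ is a partition of $[0,1]^p$ into $K^j$ cells, with leaf value vector $M^j=(\mu^j_1,\dots,\mu^j_{K^j})^\top\in\mathbb{R}^{K^j}$; $\mathcal{M}=(M^1,\dots,M^m)$ is the stacked vector of all leaf values, and $f_{\mathcal{E},\mathcal{M}}(x)=\sum_{j=1}^m\sum_{k=1}^{K^j}\mu^j_k\mathbf{1}_{T^j_k}(x)$. Let $E_A$ be the $|A|\times\sum_j K^j$ zero-one matrix whose row for index $i\in A$ has a one in the column of leaf $(j,k)$ iff $x_i\in T^j_k$; thus $(f_{\mathcal{E},\mathcal{M}}(x_i))_{i\in A}=E_A\mathcal{M}$, and every row of $E_A$ contains exactly $m$ ones. Pseudo-response model. $\widetilde Z_A\mid c,\mathcal{E},\mathcal{M}\sim\mathcal{N}(E_A\mathcal{M},I_{|A|})$ with prior $\mathcal{M}\mid c,\mathcal{E}\sim\mathcal{N}(0,cI)$. Hence, with $\mathcal{M}$ integrated out, $\widetilde Z_A\mid c,\mathcal{E}\sim\mathcal{N}(0,cE_AE_A^\top+I_{|A|})$, whose marginal variances all equal $1+mc=s^{-2}$ and whose correlation matrix is $\Omega=s^2(cE_AE_A^\top+I_{|A|})$. Copula process model. The law $\mathbb{P}_{Y_A\mid c,\mathcal{E}}$ is the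 Gaussian copula model with all margins $F_Y$ and copula parameter $\Omega$, i.e. it has density $$p(y_A\mid c,\mathcal{E})=|\Omega|^{-1/2}\exp\Big(-\tfrac12 z_A^\top(\Omega^{-1}-I_{|A|})z_A\Big)\prod_{i\in A}p_Y(y_i),\qquad z_i=\Phi^{-1}(F_Y(y_i)).$$ This copula is the implicit copula of $\widetilde Z_A\mid c,\mathcal{E}$, and the joint law of $(Y_A,\widetilde Z_A,\mathcal{M})$ given $c,\mathcal{E}$ is the one in which $F_Y(Y_i)=\Phi(s\widetilde Z_i)$ almost surely for all $i\in A$; $\mathbb{P}_{Y_A\mid c,\mathcal{E},\mathcal{M}}$ is the resulting conditional law of $Y_A$ given $\mathcal{M}$. *)

theory Defs
  imports "HOL-Probability.Probability"
begin

text \<open>Trees are numbered \<open>1..m\<close>, and \<open>T j k\<close> with \<open>k \<in> {1..K j}\<close> are the cells of the \<open>j\<close>-th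
  partition. Injectivity makes \<open>K j\<close> the number of cells.\<close>

definition tree_ensemble :: "nat \<Rightarrow> (nat \<Rightarrow> nat) \<Rightarrow> (nat \<Rightarrow> nat \<Rightarrow> (real ^ 'p) set) \<Rightarrow> bool" where
  "tree_ensemble m K T \<longleftrightarrow>
     (\<forall>j\<in>{1..m}. inj_on (T j) {1..K j} \<and> partition_on (cbox 0 1) (T j ` {1..K j}))"

text \<open>The stacked vector of all leaf values is an element of \<^typ>\<open>real ^ 'l\<close>, where
  \<open>leaf :: 'l \<Rightarrow> nat \<times> nat\<close> is a bijection onto the set of leaf labels \<open>(j, k)\<close>; that is, \<open>leaf\<close>
  fixes the order of stacking and \<open>CARD('l) = (\<Sum>j=1..m. K j)\<close>.\<close>

definition stacking :: "nat \<Rightarrow> (nat \<Rightarrow> nat) \<Rightarrow> ('l::finite \<Rightarrow> nat \<times> nat) \<Rightarrow> bool" where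
  "stacking m K leaf \<longleftrightarrow> bij_betw leaf UNIV (SIGMA j:{1..m}. {1..K j})"

definition leaf_matrix ::
  "(nat \<Rightarrow> nat \<Rightarrow> (real ^ 'p) set) \<Rightarrow> ('l::finite \<Rightarrow> nat \<times> nat) \<Rightarrow> ('n \<Rightarrow> real ^ 'p) \<Rightarrow> real ^ 'l ^ 'n" where
  "leaf_matrix T leaf x = (\<chi> i l. case leaf l of (j, k) \<Rightarrow> if x i \<in> T j k then 1 else 0)"

text \<open>The multivariate normal law; meaningful for positive definite \<open>\<Sigma>\<close>.\<close>

definition mvn :: "real ^ 'n \<Rightarrow> real ^ 'n ^ 'n \<Rightarrow> (real ^ 'n) measure" where
  "mvn \<mu> \<Sigma> = density lborel (\<lambda>z.
     ennreal (exp (- (1/2) * ((z - \<mu>) \<bullet> (matrix_inv \<Sigma> *v (z - \<mu>)))) / sqrt ((2 * pi) ^ CARD('n) * det \<Sigma>)))"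

text \<open>The value is the usual one for \<open>0 < u < 1\<close>. At \<open>u = 0\<close> and \<open>u = 1\<close>, where the quantile may be
  infinite, it is an irrelevant real number.\<close>

definition quantile :: "(real \<Rightarrow> real) \<Rightarrow> real \<Rightarrow> real" where
  "quantile F u = Inf {y. u \<le> F y}"

abbreviation std_normal_cdf :: "real \<Rightarrow> real" where
  "std_normal_cdf \<equiv> cdf (density lborel std_normal_density)"

text \<open>The Gaussian copula model with all margins having distribution function \<open>F\<close> and density \<open>p\<close>,
  and copula parameter (correlation matrix) \<open>\<Omega>\<close>. If \<open>F (y $ i)\<close> is \<open>0\<close> or \<open>1\<close>, then
  \<open>p (y $ i) = 0\<close> outside a null set, so the value of \<^const>\<open>quantile\<close> there does not matter.\<close>

definition gaussian_copula_density ::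
  "real ^ 'n ^ 'n \<Rightarrow> (real \<Rightarrow> real) \<Rightarrow> (real \<Rightarrow> real) \<Rightarrow> real ^ 'n \<Rightarrow> real" where
  "gaussian_copula_density \<Omega> F p y =
     (let z = (\<chi> i. quantile std_normal_cdf (F (y $ i)))
      in det \<Omega> powr (- (1/2)) * exp (- (1/2) * (z \<bullet> ((matrix_inv \<Omega> - mat 1) *v z)))
           * (\<Prod>i\<in>UNIV. p (y $ i)))"

definition gaussian_copula_law ::
  "real ^ 'n ^ 'n \<Rightarrow> (real \<Rightarrow> real) \<Rightarrow> (real \<Rightarrow> real) \<Rightarrow> (real ^ 'n) measure" where
  "gaussian_copula_law \<Omega> F p = density lborel (\<lambda>y. ennreal (gaussian_copula_density \<Omega> F p y))"

text \<open>\<open>\<kappa>\<close> is a regular version of the conditional law of \<open>V\<close> given \<open>U\<close>.\<close>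

definition conditional_law ::
  "'w measure \<Rightarrow> ('w \<Rightarrow> 'a::topological_space) \<Rightarrow> ('w \<Rightarrow> 'b::topological_space) \<Rightarrow> ('a \<Rightarrow> 'b measure) \<Rightarrow> bool" where
  "conditional_law P U V \<kappa> \<longleftrightarrow>
     \<kappa> \<in> borel \<rightarrow>\<^sub>M prob_algebra borel \<and>
     (\<forall>A\<in>sets borel. \<forall>B\<in>sets borel.
        emeasure P {\<omega> \<in> space P. U \<omega> \<in> A \<and> V \<omega> \<in> B} = (\<integral>\<^sup>+u\<in>A. emeasure (\<kappa> u) B \<partial>distr P borel U))"

definition transport_map :: "'a::euclidean_space measure \<Rightarrow> 'a measure \<Rightarrow> ('a \<Rightarrow> 'a) \<Rightarrow> bool" where
  "transport_map \<mu> \<nu> T \<longleftrightarrow> T \<in> borel_measurable borel \<and> distr \<mu> borel T = \<nu>"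

text \<open>The cost is an integral in \<open>[0, \<infinity>]\<close>, as no second moments are assumed.\<close>

definition optimal_transport_map :: "'a::euclidean_space measure \<Rightarrow> 'a measure \<Rightarrow> ('a \<Rightarrow> 'a) \<Rightarrow> bool" where
  "optimal_transport_map \<mu> \<nu> R \<longleftrightarrow>
     transport_map \<mu> \<nu> R \<and>
     (\<forall>T. transport_map \<mu> \<nu> T \<longrightarrow>
        (\<integral>\<^sup>+z. ennreal ((norm (z - R z))\<^sup>2) \<partial>\<mu>) \<le> (\<integral>\<^sup>+z. ennreal ((norm (z - T z))\<^sup>2) \<partial>\<mu>))"

end

theory Submission
  imports Defs
begin

text \<open>Integrating out the leaf values by completing the square shows that the pseudo-responses have
  law \<open>N(0, \<Sigma>)\<close> with \<open>\<Sigma> = c E E\<^sup>T + I\<close>. The map \<open>R\<close> acts on each coordinate by the nondecreasing function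
  \<open>r(t) = F\<^sup>-\<^sup>1(\<Phi>(s t))\<close>. Almost surely \<open>Y = R(Z)\<close>: a level \<open>u\<close> at which \<open>F\<close> is flat is attained by \<open>F\<close> at a
  rational point, so there are countably many such levels, and \<open>\<Phi>(s Z\<^sub>i)\<close> has no atoms. This gives both
  push-forward statements. For optimality the quadratic cost is a sum over coordinates, and a map \<open>T\<close>
  with the same image law as \<open>R\<close> has coordinates \<open>T\<^sub>i\<close> distributed as \<open>r(z\<^sub>i)\<close>, so the claim reduces to the
  optimality of the monotone rearrangement on the real line.\<close>

section \<open>Quantile functions and the normal distribution function\<close>

text \<open>\<open>mvn\<close> is given by a density formula, so total mass one is something to be
  proved for the covariance \<open>c E E^T + I\<close>. That matrix is the identity plus outer
  products of the columns of \<open>sqrt c * E\<close>. Each such summand changes inverse and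
  determinant by an explicit formula, so induction over the columns gives positivity of the
  determinant and the mass together. Once the mass is known, the constant left over from integrating
  out the leaf values never has to be computed. The margins need not have second moments, so the
  cost may be infinite, and optimality cannot be reduced to comparing the mixed moments in an
  expanded square. Instead the cost is written as an integral of probabilities of joint events, and
  these are compared pointwise.\<close>

lemma quantile_le_iff:
  assumes "real_distribution D" and "0 < u" "u < 1"
  shows "quantile (cdf D) u \<le> y \<longleftrightarrow> u \<le> cdf D y"
proof -
  interpret cdf_distribution D using assms(1) by (simp add: cdf_distribution_def)
  show ?thesis unfolding quantile_def using pseudoinverse[OF assms(2,3)] by (rule sym)
qed

text \<open>The Galois connection alone gives \<open>\<ge>\<close>. A strict inequality would be a
  jump at the quantile: everything to the left of it has level at most \<open>u\<close>, and
  continuity carries this bound to the limit.\<close>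

lemma cdf_quantile:
  assumes D: "real_distribution D" and cont: "\<And>y. isCont (cdf D) y" and u: "0 < u" "u < 1"
  shows "cdf D (quantile (cdf D) u) = u"
proof (rule antisym)
  let ?q = "quantile (cdf D) u"
  note iff = quantile_le_iff[OF D u]
  show "u \<le> cdf D ?q" using iff[of ?q] by simp
  have "(cdf D \<longlongrightarrow> cdf D ?q) (at_left ?q)"
    using cont[of ?q] by (simp add: isCont_def filterlim_at_split)
  moreover have "cdf D y \<le> u" if "y < ?q" for y
    using iff[of y] that by linarith
  then have "\<forall>\<^sub>F y in at_left ?q. cdf D y \<le> u"
    unfolding eventually_at_filter by (intro always_eventually) auto
  ultimately show "cdf D ?q \<le> u"
    by (rule tendsto_upperbound) simp
qed

text \<open>The inverse function rule needs continuity of the quantile at \<open>u\<close>, which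
  can fail where \<open>F\<close> is flat. A positive derivative at the single point
  \<open>quantile (cdf D) u\<close> suffices: \<open>F\<close> is then strictly below
  \<open>u\<close> just left of it and strictly above just right of it, which traps the quantiles of
  nearby levels.\<close>

lemma quantile_has_real_derivative:
  assumes D: "real_distribution D" and cont: "\<And>y. isCont (cdf D) y" and u: "0 < u" "u < 1"
    and der: "(cdf D has_real_derivative f) (at (quantile (cdf D) u))" and f: "f > 0"
  shows "(quantile (cdf D) has_real_derivative inverse f) (at u)"
proof -
  let ?q = "quantile (cdf D)"
  have Fq: "cdf D (?q v) = v" if "0 < v" "v < 1" for v
    using cdf_quantile[OF D cont that] .
  have "isCont ?q u"
    unfolding isCont_def
  proof (rule tendstoI)
    fix e :: real assume e: "e > 0"
    obtain d1 where d1: "d1 > 0" "\<And>h. 0 < h \<Longrightarrow> h < d1 \<Longrightarrow> cdf D (?q u) < cdf D (?q u + h)"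
      using DERIV_pos_inc_right[OF der f] by blast
    obtain d2 where d2: "d2 > 0" "\<And>h. 0 < h \<Longrightarrow> h < d2 \<Longrightarrow> cdf D (?q u - h) < cdf D (?q u)"
      using DERIV_pos_inc_left[OF der f] by blast
    define h where "h = min (e/2) (min (d1/2) (d2/2))"
    have h: "0 < h" "h < d1" "h < d2" "h < e" using d1(1) d2(1) e by (auto simp: h_def min_def)
    have "cdf D (?q u - h) < u" "u < cdf D (?q u + h)"
      using d1(2)[OF h(1,2)] d2(2)[OF h(1,3)] Fq[OF u] by auto
    then have "\<forall>\<^sub>F v in at u. v \<in> {cdf D (?q u - h)<..<cdf D (?q u + h)} \<inter> {0<..<1}"
      using u by (intro eventually_at_in_open') auto
    then show "\<forall>\<^sub>F v in at u. dist (?q v) (?q u) < e"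
    proof eventually_elim
      case (elim v)
      then have "?q v \<le> ?q u + h" "\<not> ?q v \<le> ?q u - h"
        by (subst quantile_le_iff[OF D]; auto)+
      then show ?case using h(4) by (auto simp: dist_real_def)
    qed
  qed
  then show ?thesis
    using f u Fq by (intro DERIV_inverse_function[where f="cdf D" and a=0 and b=1] der) auto
qed

section \<open>The standard normal distribution function\<close>

lemma std_normal_cdf_DERIV:
  "(std_normal_cdf has_real_derivative std_normal_density x) (at x)"
proof -
  interpret real_distribution std_normal_distribution by (rule real_dist_normal_dist)
  \<comment> \<open>The fundamental theorem is applied on a bounded interval with \<open>x\<close>
    in its interior; the constant \<open>std_normal_cdf ?a\<close> absorbs the left tail.\<close>
  let ?a = "x - 1" and ?b = "x + 1"
  have c: "continuous_on S std_normal_density" for S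
    unfolding std_normal_density_def by (intro continuous_intros) auto
  have eq: "std_normal_cdf y = std_normal_cdf ?a + integral {?a..y} std_normal_density" if "?a < y" for y
  proof -
    have i: "set_integrable lborel {?a..y} std_normal_density"
      by (rule borel_integrable_atLeastAtMost') (rule c)
    have "std_normal_cdf y - std_normal_cdf ?a = measure std_normal_distribution {?a<..y}"
      using that by (rule cdf_diff_eq)
    also have "\<dots> = (LINT t:{?a<..y}|lborel. std_normal_density t)"
    proof -
      have "set_integrable lborel {?a<..y} std_normal_density"
        by (rule set_integrable_subset[OF i]) auto
      then show ?thesis
        by (auto simp: measure_def emeasure_density nn_integral_eq_integral ennreal_indicator[symmetric]
              ennreal_mult[symmetric] set_integrable_def set_lebesgue_integral_def mult.commute)
    qed
    also have "\<dots> = (LINT t:{?a..y}|lborel. std_normal_density t)"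
    proof (rule set_integral_null_delta)
      have "sym_diff {?a<..y} {?a..y} = {?a}" using that by auto
      then show "sym_diff {?a<..y} {?a..y} \<in> null_sets lborel" by (simp add: null_setsI)
    qed auto
    also have "\<dots> = integral {?a..y} std_normal_density"
      by (rule set_borel_integral_eq_integral(2)[OF i])
    finally show ?thesis by simp
  qed
  have "((\<lambda>y. integral {?a..y} std_normal_density) has_real_derivative std_normal_density x) (at x within {?a..?b})"
    by (rule integral_has_real_derivative[OF c]) auto
  then have "((\<lambda>y. std_normal_cdf ?a + integral {?a..y} std_normal_density) has_real_derivative std_normal_density x) (at x)"
    by (subst (asm) at_within_Icc_at) (auto intro!: derivative_eq_intros)
  then show ?thesis
    by (rule has_field_derivative_transform_within_open[of _ _ _ "{?a<..<?b}"]) (auto simp: eq)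
qed

lemma isCont_std_normal_cdf: "isCont std_normal_cdf x"
  using std_normal_cdf_DERIV by (rule DERIV_isCont)

lemma std_normal_cdf_less: "x < y \<Longrightarrow> std_normal_cdf x < std_normal_cdf y"
  by (rule DERIV_pos_imp_increasing[where f=std_normal_cdf])
     (blast intro: std_normal_cdf_DERIV normal_density_pos[OF zero_less_one])+

lemma std_normal_cdf_bounds: "0 < std_normal_cdf x" "std_normal_cdf x < 1"
proof -
  interpret real_distribution std_normal_distribution by (rule real_dist_normal_dist)
  show "0 < std_normal_cdf x"
    using std_normal_cdf_less[of "x - 1" x] cdf_nonneg[of "x - 1"] by simp
  show "std_normal_cdf x < 1"
    using std_normal_cdf_less[of x "x + 1"] cdf_bounded_prob[of "x + 1"] by simp
qed

lemma std_normal_cdf_mono_iff: "std_normal_cdf x \<le> std_normal_cdf y \<longleftrightarrow> x \<le> y"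
  using std_normal_cdf_less[of x y] std_normal_cdf_less[of y x] by (cases x y rule: linorder_cases) simp_all

lemma borel_measurable_std_normal_cdf [measurable]: "std_normal_cdf \<in> borel_measurable borel"
  by (rule borel_measurable_mono) (simp add: mono_def std_normal_cdf_mono_iff)

lemma std_normal_cdf_eq_iff: "std_normal_cdf x = std_normal_cdf y \<longleftrightarrow> x = y"
  using std_normal_cdf_less[of x y] std_normal_cdf_less[of y x] by (cases x y rule: linorder_cases) simp_all

lemma quantile_std_normal_cdf: "quantile std_normal_cdf (std_normal_cdf x) = x"
  using cdf_quantile[OF real_dist_normal_dist isCont_std_normal_cdf std_normal_cdf_bounds, of x]
  by (simp only: std_normal_cdf_eq_iff)

lemma quantile_measurable:
  assumes D: "real_distribution D"
  shows "quantile (cdf D) \<in> borel_measurable borel"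
proof -
  interpret cdf_distribution D using assms(1) by (simp add: cdf_distribution_def)
  let ?q = "quantile (cdf D)"
  have q1: "?q \<in> borel_measurable (restrict_space borel {0<..<1})"
    using measurable_CI unfolding quantile_def[abs_def] .
  have lo: "?q u = ?q 0" if "u \<le> 0" for u
    using that cdf_nonneg by (auto simp: quantile_def intro!: arg_cong[where f=Inf] intro: order_trans)
  have hi: "?q u = ?q 2" if "1 < u" for u
  proof -
    have "{y. u \<le> cdf D y} = {}" "{y. 2 \<le> cdf D y} = {}"
      using that cdf_bounded_prob by (smt (verit) Collect_empty_eq)+
    then show ?thesis by (simp add: quantile_def)
  qed
  \<comment> \<open>The set under the infimum is the whole line for \<open>u \<le> 0\<close> and
    empty for \<open>u > 1\<close>, so the default values there are constant. The level
    \<open>1\<close> is a piece of its own because which of the sets arises there depends on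
    \<open>D\<close>.\<close>
  let ?C = "{{..0}, {0<..<1}, {1}, {1<..}} :: real set set"
  show ?thesis
  proof (rule measurable_piecewise_restrict[of ?C])
    fix A assume "A \<in> ?C"
    then consider "A = {..0}" | "A = {0<..<1}" | "A = {1}" | "A = {1<..}" by auto
    then show "?q \<in> borel_measurable (restrict_space borel A)"
    proof cases
      case 1
      show ?thesis by (subst measurable_cong[where g="\<lambda>_. ?q 0"]) (auto simp: 1 space_restrict_space intro: lo)
    next
      case 2 then show ?thesis using q1 by simp
    next
      case 3
      show ?thesis by (subst measurable_cong[where g="\<lambda>_. ?q 1"]) (auto simp: 3 space_restrict_space)
    next
      case 4
      show ?thesis by (subst measurable_cong[where g="\<lambda>_. ?q 2"]) (auto simp: 4 space_restrict_space intro: hi)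
    qed
  qed auto
qed

text \<open>Inverse transform sampling: by the Galois connection the event that the image is at most
  \<open>y\<close> is \<open>\<Phi>(z) \<le> F(y)\<close>, and \<open>\<Phi>(z)\<close> is uniformly
  distributed.\<close>

lemma distr_quantile_std_normal:
  assumes D: "real_distribution D"
  shows "distr std_normal_distribution borel (\<lambda>z. quantile (cdf D) (std_normal_cdf z)) = D"
proof -
  interpret D: real_distribution D by fact
  interpret N: real_distribution std_normal_distribution by (rule real_dist_normal_dist)
  have [measurable]: "quantile (cdf D) \<in> borel_measurable borel" by (rule quantile_measurable[OF D])
  let ?r = "\<lambda>z. quantile (cdf D) (std_normal_cdf z)"
  have r: "?r \<in> borel_measurable borel" by measurable
  \<comment> \<open>Uniformity of \<open>\<Phi>(z)\<close>. The endpoints are treated separately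
    because \<open>F\<close> may attain \<open>0\<close> and \<open>1\<close> while
    \<open>\<Phi>\<close> does not.\<close>
  have *: "measure std_normal_distribution {z. std_normal_cdf z \<le> v} = v" if v: "0 \<le> v" "v \<le> 1" for v
  proof -
    consider "v = 0" | "v = 1" | "0 < v" "v < 1" using v by linarith
    then show ?thesis
    proof cases
      case 1
      have "{z. std_normal_cdf z \<le> v} = {}" using std_normal_cdf_bounds(1) by (simp add: 1 not_le)
      then show ?thesis by (simp add: 1)
    next
      case 2
      have "{z. std_normal_cdf z \<le> v} = UNIV" using std_normal_cdf_bounds 2 by (auto intro: less_imp_le)
      then show ?thesis using 2 N.prob_space by simp
    next
      case 3
      define w where "w = quantile std_normal_cdf v"
      have w: "std_normal_cdf w = v"
        unfolding w_def by (rule cdf_quantile[OF real_dist_normal_dist isCont_std_normal_cdf 3])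
      have "{z. std_normal_cdf z \<le> v} = {..w}" by (auto simp: w[symmetric] std_normal_cdf_mono_iff)
      then show ?thesis using w by (simp add: cdf_def)
    qed
  qed
  show ?thesis
  proof (rule cdf_unique)
    show "real_distribution (distr std_normal_distribution borel ?r)"
      by (rule N.real_distribution_distr) (use r in simp)
    show "real_distribution D" by fact
    show "cdf (distr std_normal_distribution borel ?r) = cdf D"
    proof
      fix y
      have "cdf (distr std_normal_distribution borel ?r) y = measure std_normal_distribution (?r -` {..y})"
        using r by (simp add: cdf_def measure_distr)
      also have "?r -` {..y} = {z. std_normal_cdf z \<le> cdf D y}"
        by (auto simp: quantile_le_iff[OF D std_normal_cdf_bounds])
      finally show "cdf (distr std_normal_distribution borel ?r) y = cdf D y"
        using *[of "cdf D y"] D.cdf_nonneg D.cdf_bounded_prob by simp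
    qed
  qed
qed

lemma distr_scaled_normal:
  assumes s: "s > 0"
  shows "distr (density lborel (normal_density 0 (1/s))) borel (\<lambda>z. s * z) = std_normal_distribution"
proof -
  interpret prob_space "density lborel (normal_density 0 (1/s))"
    using s by (intro prob_space_normal_density) simp
  have "distributed (density lborel (normal_density 0 (1/s))) lborel (\<lambda>z. z) (normal_density 0 (1/s))"
    by (auto simp: distributed_def distr_id2)
  from normal_density_affine[OF this, of s 0] s
  have "distributed (density lborel (normal_density 0 (1/s))) lborel (\<lambda>z. s * z) std_normal_density"
    by simp
  then show ?thesis by (simp add: distributed_def cong: distr_cong)
qed

lemma distr_quantile_scaled_normal:
  assumes D: "real_distribution D" and s: "s > 0"
  shows "distr (density lborel (normal_density 0 (1/s))) borel (\<lambda>z. quantile (cdf D) (std_normal_cdf (s * z))) = D"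
proof -
  have [measurable]: "quantile (cdf D) \<in> borel_measurable borel" by (rule quantile_measurable[OF D])
  have "distr (distr (density lborel (normal_density 0 (1/s))) borel (\<lambda>z. s * z)) borel (\<lambda>z. quantile (cdf D) (std_normal_cdf z)) = D"
    unfolding distr_scaled_normal[OF s] by (rule distr_quantile_std_normal[OF D])
  then show ?thesis by (subst (asm) distr_distr) (auto simp: comp_def)
qed

section \<open>Rank-one updates of positive definite matrices\<close>

text \<open>Multilinearity, updating one row at a time. Splitting the new row \<open>k\<close> of
  \<open>D (insert k S)\<close> into its unit vector and its multiple of \<open>w\<close> leaves
  \<open>D S\<close> and \<open>u $ k\<close> times \<open>C k S\<close>.\<close>

lemma det_rank_one:
  fixes u w :: "real ^ 'n::finite"
  shows "det (mat 1 + (\<chi> i j. u $ i * w $ j)) = 1 + w \<bullet> u"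
proof -
  \<comment> \<open>Row \<open>k\<close> of \<open>C k S\<close> is \<open>w\<close> itself, so row
    operations clear the multiples of \<open>w\<close> from the other rows and the determinant is
    \<open>w $ k\<close> whatever \<open>S\<close> is.\<close>
  define C where "C k S = (\<chi> i. if i = k then w else if i \<in> S then axis i 1 + u $ i *s w else axis i 1)" for k S
  define D where "D S = (\<chi> i. if i \<in> S then axis i 1 + u $ i *s w else axis i (1::real))" for S
  have C: "det (C k S) = w $ k" if "finite S" "k \<notin> S" for k S
    using that
  proof (induction S rule: finite_induct)
    case empty
    have "C k {} = (\<chi> i. if i = k then \<Sum>i\<in>UNIV. w $ i *s row i (mat 1 :: real^'n^'n) else row i (mat 1))"
      by (simp add: C_def vec_eq_iff row_def mat_def axis_def if_distrib[of "\<lambda>x. _ * x"] cong: if_cong)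
    then show ?case by (simp add: cramer_lemma_transpose)
  next
    case (insert j S)
    then have "j \<noteq> k" by auto
    then have "C k (insert j S) = (\<chi> i. if i = j then row j (C k S) + u $ j *s row k (C k S) else row i (C k S))"
      using insert.hyps by (auto simp: C_def vec_eq_iff row_def)
    then show ?case using insert \<open>j \<noteq> k\<close> by (simp add: det_row_operation)
  qed
  have D: "det (D S) = 1 + (\<Sum>i\<in>S. w $ i * u $ i)" if "finite S" for S
    using that
  proof (induction S rule: finite_induct)
    case empty
    have "D {} = mat 1" by (simp add: D_def vec_eq_iff mat_def axis_def)
    then show ?case by simp
  next
    case (insert k S)
    let ?c = "\<lambda>i. if i \<in> S then axis i 1 + u $ i *s w else axis i (1::real)"
    have "det (D (insert k S)) = det (\<chi> i. if i = k then axis i 1 + u $ i *s w else ?c i)"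
      by (rule arg_cong[where f=det]) (auto simp: D_def vec_eq_iff)
    also have "\<dots> = det (\<chi> i. if i = k then axis i 1 else ?c i) + det (\<chi> i. if i = k then u $ i *s w else ?c i)"
      by (rule det_row_add)
    also have "(\<chi> i. if i = k then u $ i *s w else ?c i) = (\<chi> i. if i = k then u $ k *s w else ?c i)"
      by (auto simp: vec_eq_iff)
    also have "det \<dots> = u $ k * det (\<chi> i. if i = k then w else ?c i)"
      by (rule det_row_mul)
    also have "(\<chi> i. if i = k then w else ?c i) = C k S" by (simp add: C_def)
    also have "det (C k S) = w $ k" using insert by (intro C) auto
    also have "(\<chi> i. if i = k then axis i 1 else ?c i) = D S"
      using insert by (auto simp: D_def vec_eq_iff)
    finally show ?case using insert by simp
  qed
  have "mat 1 + (\<chi> i j. u $ i * w $ j) = D UNIV"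
    by (simp add: D_def vec_eq_iff mat_def axis_def)
  then show ?thesis using D[of UNIV] by (simp add: inner_vec_def)
qed

section \<open>Positive definite matrices and their inverses\<close>

definition pos_def :: "real ^ 'n ^ 'n \<Rightarrow> bool" where
  "pos_def \<Sigma> \<longleftrightarrow> transpose \<Sigma> = \<Sigma> \<and> (\<forall>z. z \<noteq> 0 \<longrightarrow> 0 < z \<bullet> (\<Sigma> *v z))"

lemma pos_def_invertible: "pos_def \<Sigma> \<Longrightarrow> invertible \<Sigma>"
  unfolding invertible_left_inverse matrix_left_invertible_ker pos_def_def
  by (metis inner_zero_right less_irrefl)

lemma matrix_inv_mult_vec:
  fixes A :: "real ^ 'n ^ 'n"
  assumes "invertible A"
  shows "A *v (matrix_inv A *v x) = x" "matrix_inv A *v (A *v x) = x"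
proof -
  have "A ** matrix_inv A = mat 1 \<and> matrix_inv A ** A = mat 1"
    using assms unfolding invertible_def matrix_inv_def by (rule someI_ex)
  then show "A *v (matrix_inv A *v x) = x" "matrix_inv A *v (A *v x) = x"
    by (simp_all add: matrix_vector_mul_assoc)
qed

lemma matrix_inv_mult_vec_eqI:
  fixes A :: "real ^ 'n ^ 'n"
  assumes "invertible A" "A *v y = x"
  shows "matrix_inv A *v x = y"
  using matrix_inv_mult_vec(2)[OF assms(1), of y] assms(2) by simp

lemma symmetric_inner:
  fixes A :: "real ^ 'n ^ 'n"
  assumes "transpose A = A"
  shows "(A *v x) \<bullet> y = x \<bullet> (A *v y)"
  by (metis assms dot_lmul_matrix transpose_matrix_vector)

lemma pos_def_inv_inner:
  assumes "pos_def \<Sigma>"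
  shows "(matrix_inv \<Sigma> *v x) \<bullet> y = x \<bullet> (matrix_inv \<Sigma> *v y)"
proof -
  let ?A = "matrix_inv \<Sigma>"
  have "(?A *v x) \<bullet> y = (?A *v x) \<bullet> (\<Sigma> *v (?A *v y))"
    using assms by (simp add: matrix_inv_mult_vec pos_def_invertible)
  also have "\<dots> = x \<bullet> (?A *v y)"
    using assms by (simp add: pos_def_def flip: symmetric_inner) (simp add: assms matrix_inv_mult_vec pos_def_invertible)
  finally show ?thesis .
qed

lemma pos_def_inv_nonneg:
  assumes "pos_def \<Sigma>"
  shows "0 \<le> x \<bullet> (matrix_inv \<Sigma> *v x)"
proof -
  let ?y = "matrix_inv \<Sigma> *v x"
  have "0 \<le> ?y \<bullet> (\<Sigma> *v ?y)"
    using assms by (cases "?y = 0") (auto simp: pos_def_def intro: less_imp_le)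
  then show ?thesis
    using assms by (simp add: matrix_inv_mult_vec pos_def_invertible inner_commute)
qed

abbreviation outer :: "real ^ 'n \<Rightarrow> real ^ 'n ^ 'n" where
  "outer v \<equiv> (\<chi> i j. v $ i * v $ j)"

lemma outer_mult_vec: "outer v *v y = (v \<bullet> y) *\<^sub>R v"
  by (simp add: vec_eq_iff matrix_vector_mult_def inner_vec_def sum_distrib_left sum_distrib_right algebra_simps)

lemma pos_def_add_outer:
  assumes "pos_def \<Sigma>"
  shows "pos_def (\<Sigma> + outer v)"
proof -
  have "transpose (\<Sigma> + outer v) = \<Sigma> + outer v"
    using assms by (simp add: pos_def_def transpose_def vec_eq_iff mult.commute)
  moreover have "0 < z \<bullet> ((\<Sigma> + outer v) *v z)" if "z \<noteq> 0" for z
  proof -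
    have "z \<bullet> ((\<Sigma> + outer v) *v z) = z \<bullet> (\<Sigma> *v z) + (v \<bullet> z)\<^sup>2"
      by (simp add: matrix_vector_mult_add_rdistrib outer_mult_vec inner_add_right power2_eq_square inner_commute)
    then show ?thesis using assms that by (simp add: pos_def_def add_pos_nonneg)
  qed
  ultimately show ?thesis by (simp add: pos_def_def)
qed

text \<open>The Sherman-Morrison formula, as a quadratic form. Positive definiteness keeps the
  denominator at least \<open>1\<close>.\<close>

lemma inv_add_outer_inner:
  assumes \<Sigma>: "pos_def \<Sigma>"
  shows "z \<bullet> (matrix_inv (\<Sigma> + outer v) *v z) =
    z \<bullet> (matrix_inv \<Sigma> *v z) - (v \<bullet> (matrix_inv \<Sigma> *v z))\<^sup>2 / (1 + v \<bullet> (matrix_inv \<Sigma> *v v))"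
proof -
  let ?A = "matrix_inv \<Sigma>"
  define b where "b = v \<bullet> (?A *v z)"
  define d where "d = 1 + v \<bullet> (?A *v v)"
  have d: "d > 0" using pos_def_inv_nonneg[OF \<Sigma>, of v] by (simp add: d_def)
  \<comment> \<open>A solution of \<open>(\<Sigma> + v v^T) y = z\<close> must be
    \<open>\<Sigma>^-1 z - (v \<bullet> y) \<Sigma>^-1 v\<close>; taking the inner product with
    \<open>v\<close> forces \<open>v \<bullet> y = b / d\<close>.\<close>
  define y where "y = ?A *v z - (b / d) *\<^sub>R (?A *v v)"
  have "v \<bullet> y = b - (b / d) * (d - 1)" by (simp add: y_def b_def d_def inner_diff_right)
  also have "\<dots> = b / d" using d by (simp add: field_simps)
  finally have vy: "v \<bullet> y = b / d" .
  have "(\<Sigma> + outer v) *v y = z"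
    using \<Sigma> by (simp add: matrix_vector_mult_add_rdistrib outer_mult_vec vy)
      (simp add: y_def matrix_vector_mult_diff_distrib matrix_vector_mult_scaleR matrix_inv_mult_vec pos_def_invertible)
  then have "matrix_inv (\<Sigma> + outer v) *v z = y"
    by (intro matrix_inv_mult_vec_eqI pos_def_invertible pos_def_add_outer \<Sigma>)
  moreover have "z \<bullet> (?A *v v) = b"
    using pos_def_inv_inner[OF \<Sigma>, of z v] by (simp add: b_def inner_commute)
  ultimately show ?thesis
    unfolding b_def[symmetric] d_def[symmetric]
    by (simp add: y_def inner_diff_right power2_eq_square)
qed

text \<open>Factoring out \<open>\<Sigma>\<close> leaves the identity plus the rank-one matrix of
  \<open>\<Sigma>^-1 v\<close> and \<open>v\<close>.\<close>

lemma det_add_outer: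
  fixes \<Sigma> :: "real ^ 'n ^ 'n"
  assumes \<Sigma>: "invertible \<Sigma>"
  shows "det (\<Sigma> + outer v) = det \<Sigma> * (1 + v \<bullet> (matrix_inv \<Sigma> *v v))"
proof -
  let ?u = "matrix_inv \<Sigma> *v v"
  have "((\<Sigma> ** (mat 1 + (\<chi> i j. ?u $ i * v $ j)))) *v y = (\<Sigma> + outer v) *v y" for y
  proof -
    have "(\<chi> i j. ?u $ i * v $ j) *v y = (v \<bullet> y) *\<^sub>R ?u"
      by (simp add: vec_eq_iff matrix_vector_mult_def[of "\<chi> i j. _ i j"] inner_vec_def sum_distrib_left sum_distrib_right algebra_simps)
    then show ?thesis
      by (simp add: matrix_vector_mul_assoc[symmetric] matrix_vector_mult_add_rdistrib outer_mult_vec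
          matrix_vector_right_distrib matrix_vector_mult_scaleR matrix_inv_mult_vec \<Sigma>)
  qed
  then have "\<Sigma> + outer v = \<Sigma> ** (mat 1 + (\<chi> i j. ?u $ i * v $ j))"
    by (metis matrix_eq)
  then show ?thesis by (simp add: det_mul det_rank_one)
qed

section \<open>Multivariate normal laws\<close>

lemma nn_integral_lborel_vec_prod:
  fixes f :: "'n::finite \<Rightarrow> real \<Rightarrow> ennreal"
  assumes "\<And>i. f i \<in> borel_measurable borel"
  shows "(\<integral>\<^sup>+x. (\<Prod>i\<in>UNIV. f i (x $ i)) \<partial>(lborel :: (real ^ 'n) measure)) = (\<Prod>i\<in>UNIV. \<integral>\<^sup>+t. f i t \<partial>lborel)"
proof -
  have B: "Basis = (\<lambda>i. axis i (1::real)) ` (UNIV :: 'n set)"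
    by (auto simp: Basis_vec_def)
  have inj: "inj (\<lambda>i. axis i (1::real) :: real ^ 'n)"
    by (auto intro!: injI simp: axis_eq_axis)
  have "(\<integral>\<^sup>+x. (\<Prod>b\<in>Basis. f (axis_index b) (x \<bullet> b)) \<partial>(lborel :: (real ^ 'n) measure))
      = (\<Prod>b\<in>(Basis :: (real ^ 'n) set). \<integral>\<^sup>+t. f (axis_index b) t \<partial>lborel)"
    by (rule nn_integral_lborel_prod) (auto simp: assms)
  then show ?thesis
    unfolding B by (simp add: prod.reindex[OF inj] inner_axis)
qed

lemma nn_integral_lborel_diff:
  fixes a :: "'a::euclidean_space"
  assumes "f \<in> borel_measurable borel"
  shows "(\<integral>\<^sup>+x. f (x - a) \<partial>lborel) = (\<integral>\<^sup>+x. f x \<partial>lborel)"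
proof -
  have "(\<integral>\<^sup>+x. f x \<partial>lborel) = (\<integral>\<^sup>+x. f x \<partial>distr lborel borel ((+) (- a)))"
    by (simp add: lborel_distr_plus)
  also have "\<dots> = (\<integral>\<^sup>+x. f (x - a) \<partial>lborel)"
    using assms by (subst nn_integral_distr) auto
  finally show ?thesis by simp
qed

lemma borel_measurable_vec_nth [measurable]: "(\<lambda>z :: real ^ 'n. z $ i) \<in> borel_measurable borel"
  by (intro borel_measurable_continuous_onI continuous_intros)

lemma borel_measurable_quadratic_form [measurable]:
  fixes A :: "real ^ 'n ^ 'n"
  shows "(\<lambda>z. z \<bullet> (A *v z)) \<in> borel_measurable borel"
  by (intro borel_measurable_continuous_onI continuous_intros linear_continuous_on matrix_vector_mul_bounded_linear)

lemma borel_measurable_matrix_vector_mult [measurable]: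
  fixes A :: "real ^ 'n ^ 'm"
  shows "(\<lambda>z. A *v z) \<in> borel_measurable borel"
  by (intro borel_measurable_continuous_onI linear_continuous_on matrix_vector_mul_bounded_linear)

definition mvn_density :: "real ^ 'n ^ 'n \<Rightarrow> real ^ 'n \<Rightarrow> real" where
  "mvn_density \<Sigma> z = exp (- (1/2) * (z \<bullet> (matrix_inv \<Sigma> *v z))) / sqrt ((2 * pi) ^ CARD('n) * det \<Sigma>)"

lemma borel_measurable_mvn_density [measurable]: "mvn_density \<Sigma> \<in> borel_measurable borel"
  unfolding mvn_density_def[abs_def] by measurable

lemma mvn_eq_density: "mvn \<mu> \<Sigma> = density lborel (\<lambda>z. ennreal (mvn_density \<Sigma> (z - \<mu>)))"
  by (simp add: mvn_def mvn_density_def)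

lemma prob_space_mvn_iff:
  "prob_space (mvn \<mu> \<Sigma>) \<longleftrightarrow> (\<integral>\<^sup>+z. ennreal (mvn_density \<Sigma> z) \<partial>lborel) = 1"
proof -
  have "emeasure (mvn \<mu> \<Sigma>) UNIV = (\<integral>\<^sup>+z. ennreal (mvn_density \<Sigma> (z - \<mu>)) \<partial>lborel)"
    by (simp add: mvn_eq_density emeasure_density)
  also have "\<dots> = (\<integral>\<^sup>+z. ennreal (mvn_density \<Sigma> z) \<partial>lborel)"
    by (rule nn_integral_lborel_diff[of "\<lambda>z. ennreal (mvn_density \<Sigma> z)"]) measurable
  finally have *: "emeasure (mvn \<mu> \<Sigma>) UNIV = \<dots>" .
  have "space (mvn \<mu> \<Sigma>) = UNIV" by (simp add: mvn_def)
  then show ?thesis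
    by (metis * prob_space.emeasure_space_1 prob_spaceI)
qed

lemma det_mat: "det (mat c :: real ^ 'n ^ 'n) = c ^ CARD('n)"
  by (subst det_diagonal) (auto simp: mat_def)

lemma mat_mult_vec: "mat (c::real) *v z = c *\<^sub>R z"
  by (simp add: vec_eq_iff matrix_vector_mult_def mat_def if_distrib[of "\<lambda>a. a * _"] cong: if_cong)

lemma pos_def_mat: "c > 0 \<Longrightarrow> pos_def (mat c)"
  by (simp add: pos_def_def transpose_mat mat_mult_vec)

lemma matrix_inv_mat_mult_vec:
  fixes z :: "real ^ 'n"
  assumes "c > 0"
  shows "matrix_inv (mat c) *v z = (1 / c) *\<^sub>R z"
  using assms by (intro matrix_inv_mult_vec_eqI pos_def_invertible pos_def_mat) (simp_all add: mat_mult_vec)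

lemma mvn_density_mat:
  fixes z :: "real ^ 'n"
  assumes c: "c > 0"
  shows "mvn_density (mat c) z = (\<Prod>i\<in>UNIV. normal_density 0 (sqrt c) (z $ i))"
proof -
  have "z \<bullet> (matrix_inv (mat c) *v z) = (\<Sum>i\<in>UNIV. (z $ i)\<^sup>2 / c)"
    using c by (simp add: matrix_inv_mat_mult_vec inner_vec_def power2_eq_square sum_divide_distrib)
  then have "mvn_density (mat c) z = exp (\<Sum>i\<in>UNIV. - (z $ i)\<^sup>2 / (2 * c)) / sqrt ((2 * pi * c) ^ CARD('n))"
    by (simp add: mvn_density_def det_mat power_mult_distrib sum_negf sum_distrib_left)
  also have "\<dots> = (\<Prod>i\<in>UNIV. normal_density 0 (sqrt c) (z $ i))"
    using c by (simp add: normal_density_def exp_sum prod_dividef real_sqrt_power)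
  finally show ?thesis .
qed

lemma nn_integral_normal_density:
  assumes "0 < \<sigma>"
  shows "(\<integral>\<^sup>+t. ennreal (normal_density \<mu> \<sigma> t) \<partial>lborel) = 1"
  using prob_space.emeasure_space_1[OF prob_space_normal_density[OF assms, of \<mu>]]
  by (simp add: emeasure_density)

lemma prob_space_mvn_mat:
  assumes c: "c > 0"
  shows "prob_space (mvn (\<mu> :: real ^ 'n) (mat c))"
  unfolding prob_space_mvn_iff mvn_density_mat[OF c]
  using c by (simp add: prod_ennreal[symmetric] nn_integral_lborel_vec_prod[of "\<lambda>_ t. ennreal (normal_density 0 (sqrt c) t)"]
      nn_integral_normal_density)

text \<open>If \<open>X\<close> has law \<open>N(0, \<Sigma>)\<close> and \<open>t\<close> is an independent standard normal scalar, then \<open>X + t v\<close> has covariance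
  \<open>\<Sigma> + v v\<^sup>T\<close>. Computing its density by integrating over \<open>t\<close> shows that the density of \<open>N(0, \<Sigma> + v v\<^sup>T)\<close>
  is correctly normalised, without a linear change of variables: the library version needs a
  well-ordered index type.\<close>

lemma mvn_add_outer:
  fixes \<Sigma> :: "real ^ 'n ^ 'n"
  assumes \<Sigma>: "pos_def \<Sigma>" and det: "0 < det \<Sigma>" and prob: "prob_space (mvn 0 \<Sigma>)"
  shows "0 < det (\<Sigma> + outer v)" and "prob_space (mvn 0 (\<Sigma> + outer v))"
proof -
  let ?A = "matrix_inv \<Sigma>"
  define d where "d = 1 + v \<bullet> (?A *v v)"
  have d: "d > 0" using pos_def_inv_nonneg[OF \<Sigma>, of v] by (simp add: d_def)
  have det': "det (\<Sigma> + outer v) = det \<Sigma> * d"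
    unfolding d_def by (rule det_add_outer[OF pos_def_invertible[OF \<Sigma>]])
  then show "0 < det (\<Sigma> + outer v)" using det d by simp
  have conv: "ennreal (mvn_density (\<Sigma> + outer v) z)
      = (\<integral>\<^sup>+t. ennreal (std_normal_density t * mvn_density \<Sigma> (z - t *\<^sub>R v)) \<partial>lborel)" for z
  proof -
    define b where "b = v \<bullet> (?A *v z)"
    have zAv: "z \<bullet> (?A *v v) = b"
      using pos_def_inv_inner[OF \<Sigma>, of z v] by (simp add: b_def inner_commute)
    have quad: "(z - t *\<^sub>R v) \<bullet> (?A *v (z - t *\<^sub>R v)) = z \<bullet> (?A *v z) - 2 * t * b + t\<^sup>2 * (d - 1)" for t
      by (simp add: matrix_vector_mult_diff_distrib matrix_vector_mult_scaleR inner_diff_left inner_diff_right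
          zAv flip: b_def) (simp add: d_def algebra_simps power2_eq_square)
    have "std_normal_density t * mvn_density \<Sigma> (z - t *\<^sub>R v)
        = mvn_density (\<Sigma> + outer v) z * normal_density (b / d) (1 / sqrt d) t" for t
    proof -
      \<comment> \<open>Completing the square in \<open>t\<close>: the centre is
        \<open>b / d\<close> and the variance \<open>1 / d\<close>. The remainder
        \<open>b^2 / d\<close> is exactly the Sherman-Morrison correction, so the factor free of
        \<open>t\<close> is the new density.\<close>
      have e: "- t\<^sup>2 / 2 + - (1/2) * (z \<bullet> (?A *v z) - 2 * t * b + t\<^sup>2 * (d - 1))
         = - (1/2) * (z \<bullet> (?A *v z) - b\<^sup>2 / d) + - (t - b / d)\<^sup>2 / (2 * (1 / sqrt d)\<^sup>2)"
        using d by (simp add: field_simps power2_eq_square)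
      have "std_normal_density t * mvn_density \<Sigma> (z - t *\<^sub>R v) =
          exp (- t\<^sup>2 / 2 + - (1/2) * (z \<bullet> (?A *v z) - 2 * t * b + t\<^sup>2 * (d - 1)))
            / (sqrt (2 * pi) * sqrt ((2 * pi) ^ CARD('n) * det \<Sigma>))"
        unfolding std_normal_density_def mvn_density_def quad exp_add by simp
      also have "\<dots> = mvn_density (\<Sigma> + outer v) z * normal_density (b / d) (1 / sqrt d) t"
        unfolding e exp_add normal_density_def mvn_density_def inv_add_outer_inner[OF \<Sigma>] det' b_def[symmetric] d_def[symmetric]
        using d by (simp add: real_sqrt_mult real_sqrt_divide)
      finally show ?thesis .
    qed
    then have "(\<integral>\<^sup>+t. ennreal (std_normal_density t * mvn_density \<Sigma> (z - t *\<^sub>R v)) \<partial>lborel)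
       = (\<integral>\<^sup>+t. ennreal (mvn_density (\<Sigma> + outer v) z) * ennreal (normal_density (b / d) (1 / sqrt d) t) \<partial>lborel)"
      by (simp add: ennreal_mult'')
    also have "\<dots> = ennreal (mvn_density (\<Sigma> + outer v) z)"
      using d by (simp add: nn_integral_cmult nn_integral_normal_density)
    finally show ?thesis by simp
  qed
  have "(\<integral>\<^sup>+z. ennreal (mvn_density (\<Sigma> + outer v) z) \<partial>lborel)
      = (\<integral>\<^sup>+z. \<integral>\<^sup>+t. ennreal (std_normal_density t * mvn_density \<Sigma> (z - t *\<^sub>R v)) \<partial>lborel \<partial>lborel)"
    by (simp only: conv)
  \<comment> \<open>With \<open>z\<close> integrated first, the shift by \<open>t v\<close> is a
    mere translation, and the assumed mass of \<open>N(0, \<Sigma>)\<close> applies.\<close>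
  also have "\<dots> = (\<integral>\<^sup>+t. \<integral>\<^sup>+z. ennreal (std_normal_density t * mvn_density \<Sigma> (z - t *\<^sub>R v)) \<partial>lborel \<partial>lborel)"
    by (rule lborel_pair.Fubini') measurable
  also have "\<dots> = (\<integral>\<^sup>+t. ennreal (std_normal_density t) * (\<integral>\<^sup>+z. ennreal (mvn_density \<Sigma> (z - t *\<^sub>R v)) \<partial>lborel) \<partial>lborel)"
    by (simp add: ennreal_mult' nn_integral_cmult)
  also have "\<dots> = (\<integral>\<^sup>+t. ennreal (std_normal_density t) \<partial>lborel)"
    using prob unfolding prob_space_mvn_iff
    by (simp add: nn_integral_lborel_diff[of "\<lambda>z. ennreal (mvn_density \<Sigma> z)"])
  also have "\<dots> = 1" by (rule nn_integral_normal_density) simp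
  finally show "prob_space (mvn 0 (\<Sigma> + outer v))" unfolding prob_space_mvn_iff .
qed

text \<open>\<open>E E^T\<close> is the sum of the outer products of the columns of
  \<open>E\<close>. All three properties go through the induction together, since the step for the
  mass uses the other two.\<close>

lemma gram_covariance:
  fixes E :: "real ^ 'l ^ 'n"
  assumes c: "c > 0"
  defines "\<Sigma> \<equiv> c *\<^sub>R (E ** transpose E) + mat 1"
  shows "pos_def \<Sigma>" "0 < det \<Sigma>" "prob_space (mvn 0 \<Sigma>)"
proof -
  define v where "v l = sqrt c *\<^sub>R column l E" for l
  have "pos_def (mat 1 + (\<Sum>l\<in>S. outer (v l))) \<and> 0 < det (mat 1 + (\<Sum>l\<in>S. outer (v l)))
      \<and> prob_space (mvn 0 (mat 1 + (\<Sum>l\<in>S. outer (v l))))" if "finite S" for S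
    using that
  proof (induction S rule: finite_induct)
    case empty
    then show ?case by (simp add: pos_def_mat prob_space_mvn_mat)
  next
    case (insert l S)
    have *: "mat 1 + (\<Sum>l\<in>insert l S. outer (v l)) = mat 1 + (\<Sum>l\<in>S. outer (v l)) + outer (v l)"
      using insert.hyps by (simp add: add_ac)
    show ?case unfolding * using insert.IH by (blast intro: pos_def_add_outer mvn_add_outer)
  qed
  moreover have "\<Sigma> = mat 1 + (\<Sum>l\<in>UNIV. outer (v l))"
  proof -
    have sqrt: "sqrt c * (sqrt c * a) = c * a" for a
      using c by (simp flip: mult.assoc)
    show ?thesis
      by (simp add: \<Sigma>_def v_def vec_eq_iff matrix_matrix_mult_def transpose_def column_def
          sum_distrib_left mult_ac sum_component sqrt)
  qed
  ultimately show "pos_def \<Sigma>" "0 < det \<Sigma>" "prob_space (mvn 0 \<Sigma>)" by simp_all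
qed

text \<open>\<open>h\<close> is the conditional mean of the leaf values given \<open>z\<close>, and
  \<open>w\<close> the deviation from it. The right-hand side separates: one term is the marginal
  form in \<open>z\<close>, the other depends on \<open>w\<close> only.\<close>

lemma gram_completed_square:
  fixes E :: "real ^ 'l ^ 'n" and z :: "real ^ 'n" and w :: "real ^ 'l"
  assumes c: "c > 0"
  defines "\<Sigma> \<equiv> c *\<^sub>R (E ** transpose E) + mat 1"
  defines "h \<equiv> c *\<^sub>R (transpose E *v (matrix_inv \<Sigma> *v z))"
  shows "(w + h) \<bullet> (w + h) / c + (z - E *v (w + h)) \<bullet> (z - E *v (w + h))
    = z \<bullet> (matrix_inv \<Sigma> *v z) + (w \<bullet> w / c + (E *v w) \<bullet> (E *v w))"
proof -
  define a where "a = matrix_inv \<Sigma> *v z"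
  define e where "e = transpose E *v a"
  have h: "h = c *\<^sub>R e" by (simp add: h_def e_def a_def)
  have adj: "(E *v x) \<bullet> a = x \<bullet> e" for x
    by (metis e_def dot_lmul_matrix inner_commute transpose_matrix_vector)
  have "\<Sigma> *v a = z"
    unfolding a_def using gram_covariance(1)[OF c, of E]
    by (simp add: matrix_inv_mult_vec pos_def_invertible \<Sigma>_def)
  \<comment> \<open>\<open>\<Sigma> a = z\<close> reads \<open>c E E^T a + a = z\<close>, and
    \<open>E h\<close> is its first summand; hence \<open>a\<close> is the residual at the
    conditional mean.\<close>
  then have z: "z = E *v h + a"
    by (simp only: \<Sigma>_def h e_def matrix_vector_mult_add_rdistrib matrix_vector_mult_scaleR
        scaleR_matrix_vector_assoc[symmetric] matrix_vector_mul_assoc[symmetric] matrix_vector_mul_lid)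
  have za: "z \<bullet> a = c * (e \<bullet> e) + a \<bullet> a"
    using adj[of h] by (simp add: z inner_add_left h)
  have res: "z - E *v (w + h) = a - E *v w"
    by (simp add: z matrix_vector_right_distrib)
  have "(w + h) \<bullet> (w + h) / c = w \<bullet> w / c + 2 * (w \<bullet> e) + c * (e \<bullet> e)"
    using c by (simp add: h inner_add_left inner_add_right inner_commute field_simps)
  moreover have "(a - E *v w) \<bullet> (a - E *v w) = a \<bullet> a - 2 * (w \<bullet> e) + (E *v w) \<bullet> (E *v w)"
    using adj[of w] by (simp add: inner_diff_left inner_diff_right inner_commute)
  ultimately show ?thesis
    unfolding res a_def[symmetric] za by simp
qed

text \<open>Completing the square gives the density of the mixture up to a constant; the constant is then
  forced because both sides are probability measures.\<close>

lemma mvn_mixture: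
  fixes E :: "real ^ 'l ^ 'n"
  assumes c: "c > 0" and B[measurable]: "B \<in> sets borel"
  defines "\<Sigma> \<equiv> c *\<^sub>R (E ** transpose E) + mat 1"
  shows "(\<integral>\<^sup>+u. emeasure (mvn (E *v u) (mat 1)) B \<partial>mvn 0 (mat c)) = emeasure (mvn 0 \<Sigma>) B"
proof -
  let ?A = "matrix_inv \<Sigma>"
  define G where "G z = exp (- (1/2) * (z \<bullet> (?A *v z)))" for z
  \<comment> \<open>The product of the normalising constants of the prior and of the unit-variance
    conditional law, whose determinant is \<open>1\<close>.\<close>
  define k where "k = 1 / (sqrt ((2 * pi) ^ CARD('l) * det (mat c :: real ^ 'l ^ 'l)) * sqrt ((2 * pi) ^ CARD('n)))"
  \<comment> \<open>The joint density as a function of the deviation from the conditional mean,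
    without its factor \<open>G z\<close>. As \<open>g\<close> does not involve \<open>z\<close>,
    its integral \<open>K\<close> is a constant.\<close>
  define g where "g w = k * exp (- (1/2) * (w \<bullet> w / c + (E *v w) \<bullet> (E *v w)))" for w
  define K where "K = (\<integral>\<^sup>+w. ennreal (g w) \<partial>lborel)"
  have k: "k \<ge> 0" using c by (simp add: k_def det_mat)
  have [measurable]: "G \<in> borel_measurable borel" unfolding G_def[abs_def] by measurable
  have [measurable]: "g \<in> borel_measurable borel" unfolding g_def[abs_def] by measurable
  have g0: "0 \<le> g w" for w using k by (simp add: g_def)
  have inner: "(\<integral>\<^sup>+u. ennreal (mvn_density (mat c) u) * ennreal (mvn_density (mat 1) (z - E *v u)) \<partial>lborel)
      = ennreal (G z) * K" for z
  proof -
    define h where "h = c *\<^sub>R (transpose E *v (?A *v z))"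
    have "mvn_density (mat c) u * mvn_density (mat 1) (z - E *v u) = G z * g (u - h)" for u
    proof -
      let ?q = "u \<bullet> u / c + (z - E *v u) \<bullet> (z - E *v u)"
      have q: "?q = z \<bullet> (?A *v z) + ((u - h) \<bullet> (u - h) / c + (E *v (u - h)) \<bullet> (E *v (u - h)))"
        using gram_completed_square[OF c, where E=E and z=z and w="u - h"]
        unfolding \<Sigma>_def[symmetric] h_def[symmetric] by simp
      have "mvn_density (mat c) u * mvn_density (mat 1) (z - E *v u) = k * exp (- (1/2) * ?q)"
        using c by (simp add: mvn_density_def matrix_inv_mat_mult_vec k_def algebra_simps exp_add[symmetric] add_divide_distrib)
      also have "\<dots> = G z * g (u - h)"
        unfolding q G_def g_def by (simp add: exp_add[symmetric] algebra_simps)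
      finally show ?thesis .
    qed
    then have "(\<integral>\<^sup>+u. ennreal (mvn_density (mat c) u) * ennreal (mvn_density (mat 1) (z - E *v u)) \<partial>lborel)
       = (\<integral>\<^sup>+u. ennreal (G z) * ennreal (g (u - h)) \<partial>lborel)"
      using c by (intro nn_integral_cong) (simp add: ennreal_mult'[symmetric] ennreal_mult[symmetric] G_def g0 mvn_density_def det_mat)
    also have "\<dots> = ennreal (G z) * K"
      unfolding K_def by (simp add: nn_integral_cmult nn_integral_lborel_diff[of "\<lambda>w. ennreal (g w)"])
    finally show ?thesis .
  qed
  have mix: "(\<integral>\<^sup>+u. emeasure (mvn (E *v u) (mat 1)) B \<partial>mvn 0 (mat c)) = (\<integral>\<^sup>+z. ennreal (G z) * indicator B z \<partial>lborel) * K"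
    if [measurable]: "B \<in> sets borel" for B
  proof -
    have "(\<integral>\<^sup>+u. emeasure (mvn (E *v u) (mat 1)) B \<partial>mvn 0 (mat c))
      = (\<integral>\<^sup>+u. ennreal (mvn_density (mat c) u) * (\<integral>\<^sup>+z. ennreal (mvn_density (mat 1) (z - E *v u)) * indicator B z \<partial>lborel) \<partial>lborel)"
      by (simp add: mvn_eq_density emeasure_density nn_integral_density)
    also have "\<dots> = (\<integral>\<^sup>+u. \<integral>\<^sup>+z. ennreal (mvn_density (mat c) u) * (ennreal (mvn_density (mat 1) (z - E *v u)) * indicator B z) \<partial>lborel \<partial>lborel)"
      by (simp add: nn_integral_cmult)
    also have "\<dots> = (\<integral>\<^sup>+z. \<integral>\<^sup>+u. ennreal (mvn_density (mat c) u) * (ennreal (mvn_density (mat 1) (z - E *v u)) * indicator B z) \<partial>lborel \<partial>lborel)"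
      by (rule lborel_pair.Fubini') measurable
    also have "\<dots> = (\<integral>\<^sup>+z. (\<integral>\<^sup>+u. ennreal (mvn_density (mat c) u) * ennreal (mvn_density (mat 1) (z - E *v u)) \<partial>lborel) * indicator B z \<partial>lborel)"
      by (simp add: mult.assoc[symmetric] nn_integral_multc)
    also have "\<dots> = (\<integral>\<^sup>+z. (ennreal (G z) * indicator B z) * K \<partial>lborel)"
      unfolding inner by (simp add: mult_ac)
    also have "\<dots> = (\<integral>\<^sup>+z. ennreal (G z) * indicator B z \<partial>lborel) * K"
      by (simp add: nn_integral_multc)
    finally show ?thesis .
  qed
  define C where "C = 1 / sqrt ((2 * pi) ^ CARD('n) * det \<Sigma>)"
  have C: "C \<ge> 0" using gram_covariance(2)[OF c, of E] by (simp add: C_def \<Sigma>_def)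
  have dens: "emeasure (mvn 0 \<Sigma>) B = (\<integral>\<^sup>+z. ennreal (G z) * indicator B z \<partial>lborel) * ennreal C"
    if [measurable]: "B \<in> sets borel" for B
  proof -
    have "ennreal (mvn_density \<Sigma> z) = ennreal (G z) * ennreal C" for z
      using C by (simp add: mvn_density_def G_def C_def flip: ennreal_mult'')
    then have "emeasure (mvn 0 \<Sigma>) B = (\<integral>\<^sup>+z. (ennreal (G z) * indicator B z) * ennreal C \<partial>lborel)"
      by (simp add: mvn_eq_density emeasure_density mult_ac)
    then show ?thesis by (simp add: nn_integral_multc)
  qed
  let ?I = "\<integral>\<^sup>+z. ennreal (G z) * indicator UNIV z \<partial>lborel"
  have space: "space (mvn \<mu> S) = UNIV" for \<mu> :: "real ^ 'n" and S by (simp add: mvn_def)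
  have "emeasure (mvn (E *v u) (mat 1)) UNIV = 1" for u
    using prob_space.emeasure_space_1[OF prob_space_mvn_mat[OF zero_less_one, of "E *v u"]] by (simp only: space)
  moreover have "emeasure (mvn 0 (mat c :: real ^ 'l ^ 'l)) (space (mvn 0 (mat c))) = 1"
    by (rule prob_space.emeasure_space_1[OF prob_space_mvn_mat[OF c]])
  ultimately have "(\<integral>\<^sup>+u. emeasure (mvn (E *v u) (mat 1)) UNIV \<partial>mvn 0 (mat c)) = 1"
    by simp
  then have IK: "?I * K = 1" using mix[of UNIV] by simp
  have "emeasure (mvn 0 \<Sigma>) UNIV = 1"
    using prob_space.emeasure_space_1[OF gram_covariance(3)[OF c, of E]] by (simp only: space \<Sigma>_def)
  then have IC: "?I * ennreal C = 1" using dens[of UNIV] by simp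
  \<comment> \<open>\<open>K\<close> and \<open>ennreal C\<close> are both multiplicative inverses
    of \<open>?I\<close>. Uniqueness of inverses uses only associativity and commutativity, so it
    holds in \<open>[0, \<infinity>]\<close> without cancellation.\<close>
  have "K = (?I * ennreal C) * K" by (simp only: IC mult_1)
  also have "\<dots> = ennreal C * (?I * K)" by (simp only: mult_ac)
  finally have "K = ennreal C" by (simp only: IK mult_1_right)
  then show ?thesis using mix[OF B] dens[OF B] by simp
qed

text \<open>Lower orthants are closed under intersection, since two corners have a componentwise
  infimum, and the orthants at multiples of \<open>One\<close> exhaust the space.\<close>

lemma measure_eqI_atMost:
  fixes M N :: "'a::ordered_euclidean_space measure"
  assumes M: "finite_measure M" and sets: "sets M = sets borel" "sets N = sets borel"
    and eq: "\<And>a. emeasure M {..a} = emeasure N {..a}"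
  shows "M = N"
proof (rule measure_eqI_generator_eq)
  show "Int_stable (range (\<lambda>a::'a. {..a}))"
  proof (rule Int_stableI)
    fix A B :: "'a set" assume "A \<in> range (\<lambda>a. {..a})" "B \<in> range (\<lambda>a. {..a})"
    then obtain a b where "A = {..a}" "B = {..b}" by auto
    then have "A \<inter> B = {..inf a b}" by auto
    then show "A \<inter> B \<in> range (\<lambda>a. {..a})" by simp
  qed
  show "range (\<lambda>a::'a. {..a}) \<subseteq> Pow UNIV" by simp
  show "sets M = sigma_sets UNIV (range (\<lambda>a::'a. {..a}))" "sets N = sigma_sets UNIV (range (\<lambda>a::'a. {..a}))"
    unfolding sets borel_eq_atMost by simp_all
  show "range (\<lambda>n::nat. {..real n *\<^sub>R (One::'a)}) \<subseteq> range (\<lambda>a. {..a})" by auto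
  show "(\<Union>n::nat. {..real n *\<^sub>R (One::'a)}) = UNIV"
  proof -
    have "\<exists>n::nat. x \<le> real n *\<^sub>R One" for x :: 'a
    proof -
      obtain n :: nat where n: "norm x \<le> real n" using real_arch_simple by blast
      have "x \<bullet> i \<le> real n" if "i \<in> Basis" for i
        using Basis_le_norm[OF that, of x] n by linarith
      then show ?thesis by (auto simp: eucl_le[where 'a='a] intro!: exI[of _ n])
    qed
    then show ?thesis by auto
  qed
  show "emeasure M {..real n *\<^sub>R One} \<noteq> \<infinity>" for n :: nat
    using finite_measure.emeasure_finite[OF M] by simp
  show "emeasure M X = emeasure N X" if "X \<in> range (\<lambda>a::'a. {..a})" for X
    using that eq by auto
qed

lemma borel_measurable_vec_componentwise:
  fixes r :: "real \<Rightarrow> real"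
  assumes [measurable]: "r \<in> borel_measurable borel"
  shows "(\<lambda>z. \<chi> i. r (z $ i)) \<in> borel_measurable (borel :: (real ^ 'n) measure)"
proof -
  show ?thesis
    by (subst borel_measurable_euclidean_space) (auto simp: Basis_vec_def inner_axis)
qed

text \<open>The indicator of a lower orthant factors over the coordinates, so both sides become
  products of one-dimensional integrals. The equation is reversed at the start because finiteness is
  immediate for the explicit density on the right.\<close>

lemma distr_density_prod:
  fixes f p :: "real \<Rightarrow> ennreal" and r :: "real \<Rightarrow> real"
  assumes [measurable]: "f \<in> borel_measurable borel" "p \<in> borel_measurable borel" "r \<in> borel_measurable borel"
    and distr: "distr (density lborel f) borel r = density lborel p"
    and prob: "prob_space (density lborel p)"
  shows "distr (density lborel (\<lambda>z. \<Prod>i\<in>UNIV. f (z $ i))) borel (\<lambda>z. \<chi> i. r (z $ i))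
    = density (lborel :: (real ^ 'n) measure) (\<lambda>y. \<Prod>i\<in>UNIV. p (y $ i))" (is "?L = ?R")
proof (rule sym, rule measure_eqI_atMost)
  have R[measurable]: "(\<lambda>z. \<chi> i. r (z $ i)) \<in> borel_measurable (borel :: (real ^ 'n) measure)"
    by (rule borel_measurable_vec_componentwise) measurable
  have "(\<integral>\<^sup>+t. p t \<partial>lborel) = 1"
    using prob_space.emeasure_space_1[OF prob] by (simp add: emeasure_density)
  then have "emeasure ?R (space ?R) = 1"
    by (simp add: emeasure_density nn_integral_lborel_vec_prod[of "\<lambda>_. p"])
  then show "finite_measure ?R" by (intro finite_measureI) simp
  show "sets ?R = sets borel" "sets ?L = sets borel" by simp_all
  fix a :: "real ^ 'n"
  have ind: "indicator {..a} y = (\<Prod>i\<in>UNIV. indicator {..a $ i} (y $ i) :: ennreal)" for y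
  proof (cases "y \<le> a")
    case True then show ?thesis by (simp add: less_eq_vec_def)
  next
    case False
    then obtain i where "\<not> y $ i \<le> a $ i" by (auto simp: less_eq_vec_def)
    then have "(\<Prod>i\<in>UNIV. indicator {..a $ i} (y $ i) :: ennreal) = 0"
      by (intro prod_zero bexI[of _ i]) auto
    then show ?thesis using False by simp
  qed
  have "emeasure ?L {..a} = (\<integral>\<^sup>+y. indicator {..a} y \<partial>?L)"
    by (rule nn_integral_indicator[symmetric]) simp
  also have "\<dots> = (\<integral>\<^sup>+z. (\<Prod>i\<in>UNIV. f (z $ i)) * indicator {..a} (\<chi> i. r (z $ i)) \<partial>lborel)"
    by (subst nn_integral_distr, measurable) (subst nn_integral_density, auto)
  also have "\<dots> = (\<integral>\<^sup>+z. (\<Prod>i\<in>UNIV. f (z $ i) * indicator {..a $ i} (r (z $ i))) \<partial>lborel)"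
    by (simp add: ind prod.distrib)
  also have "\<dots> = (\<Prod>i\<in>UNIV. \<integral>\<^sup>+t. f t * indicator {..a $ i} (r t) \<partial>lborel)"
    by (rule nn_integral_lborel_vec_prod[of "\<lambda>i t. f t * indicator {..a $ i} (r t)"]) measurable
  also have "\<dots> = (\<Prod>i\<in>UNIV. \<integral>\<^sup>+t. indicator {..a $ i} t \<partial>distr (density lborel f) borel r)"
    by (subst nn_integral_distr, measurable) (subst nn_integral_density, auto)
  also have "\<dots> = (\<Prod>i\<in>UNIV. \<integral>\<^sup>+t. p t * indicator {..a $ i} t \<partial>lborel)"
    unfolding distr by (simp add: emeasure_density)
  also have "\<dots> = (\<integral>\<^sup>+y. (\<Prod>i\<in>UNIV. p (y $ i) * indicator {..a $ i} (y $ i)) \<partial>lborel)"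
    by (rule nn_integral_lborel_vec_prod[of "\<lambda>i t. p t * indicator {..a $ i} t", symmetric]) measurable
  also have "\<dots> = emeasure ?R {..a}"
    by (simp add: emeasure_density ind prod.distrib)
  finally show "emeasure ?R {..a} = emeasure ?L {..a}" by simp
qed

section \<open>The Gaussian copula law as an image measure\<close>

lemma real_distribution_density:
  "prob_space (density lborel f) \<Longrightarrow> real_distribution (density lborel (f :: real \<Rightarrow> ennreal))"
  by (simp add: real_distribution_def real_distribution_axioms_def)

lemma isCont_cdf_density:
  assumes "prob_space (density lborel p)" and [measurable]: "p \<in> borel_measurable borel"
  shows "isCont (cdf (density lborel p)) y"
proof -
  interpret real_distribution "density lborel p"
    by (rule real_distribution_density) fact
  have "{y} \<in> null_sets (density lborel p)"
  proof (subst null_sets_density_iff)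
    have "AE x in lborel. x \<in> {y} \<longrightarrow> p x = 0"
      using AE_lborel_singleton[of y] by eventually_elim simp
    then show "{y} \<in> sets lborel \<and> (AE x in lborel. x \<in> {y} \<longrightarrow> p x = 0)" by simp
  qed measurable
  then show ?thesis
    unfolding isCont_cdf by (simp add: measure_eq_0_null_sets)
qed

text \<open>The density of \<open>N(0, \<Sigma>)\<close> relative to the product law \<open>N(0, s\<^sup>-\<^sup>2 I)\<close> factors through the transport map
  \<open>R\<close>, because \<open>\<Phi>\<^sup>-\<^sup>1(F(R(z)\<^sub>i)) = s z\<^sub>i\<close>. Since \<open>R\<close> acts componentwise, it maps the product law to the
  product of the margins.\<close>

lemma distr_mvn_copula:
  fixes \<Sigma> :: "real ^ 'n ^ 'n" and p :: "real \<Rightarrow> real"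
  assumes \<Sigma>: "pos_def \<Sigma>" "0 < det \<Sigma>" and s: "s > 0" and \<Omega>: "\<Omega> = s\<^sup>2 *\<^sub>R \<Sigma>"
    and [measurable]: "p \<in> borel_measurable borel" and p0: "\<And>y. p y \<ge> 0"
    and prob: "prob_space (density lborel p)" and F: "F = cdf (density lborel p)"
  shows "distr (mvn 0 \<Sigma>) borel (\<lambda>z. \<chi> i. quantile F (std_normal_cdf (s * z $ i))) = gaussian_copula_law \<Omega> F p"
proof -
  define R :: "real ^ 'n \<Rightarrow> real ^ 'n" where "R z = (\<chi> i. quantile F (std_normal_cdf (s * z $ i)))" for z
  define q :: "real ^ 'n \<Rightarrow> real ^ 'n" where "q y = (\<chi> i. quantile std_normal_cdf (F (y $ i)))" for y
  define h where "h y = det \<Omega> powr (- (1/2)) * exp (- (1/2) * (q y \<bullet> ((matrix_inv \<Omega> - mat 1) *v q y)))" for y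
  have D: "real_distribution (density lborel p)" by (rule real_distribution_density[OF prob])
  interpret D: cdf_distribution "density lborel p" by (simp add: cdf_distribution_def D)
  have [measurable]: "quantile F \<in> borel_measurable borel"
    unfolding F by (rule quantile_measurable[OF D])
  have [measurable]: "quantile std_normal_cdf \<in> borel_measurable borel"
    by (rule quantile_measurable[OF real_dist_normal_dist])
  have [measurable]: "F \<in> borel_measurable borel" unfolding F by measurable
  have R_meas[measurable]: "R \<in> borel_measurable borel"
    unfolding R_def[abs_def]
    by (rule borel_measurable_vec_componentwise[of "\<lambda>t. quantile F (std_normal_cdf (s * t))"]) measurable
  have [measurable]: "q \<in> borel_measurable borel"
    unfolding q_def[abs_def]
    by (rule borel_measurable_vec_componentwise[of "\<lambda>t. quantile std_normal_cdf (F t)"]) measurable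
  have [measurable]: "h \<in> borel_measurable borel"
    unfolding h_def[abs_def] by measurable
  have qR: "q (R z) = s *\<^sub>R z" for z
  proof -
    have "F (quantile F (std_normal_cdf (s * z $ i))) = std_normal_cdf (s * z $ i)" for i
      unfolding F by (rule cdf_quantile[OF D isCont_cdf_density[OF prob] std_normal_cdf_bounds]) simp
    then show ?thesis by (simp add: q_def R_def vec_eq_iff quantile_std_normal_cdf)
  qed
  have det_\<Omega>: "det \<Omega> = (s ^ CARD('n))\<^sup>2 * det \<Sigma>"
  proof -
    have "\<Omega> = mat (s\<^sup>2) ** \<Sigma>"
      by (simp add: \<Omega> vec_eq_iff matrix_matrix_mult_def mat_def if_distrib[of "\<lambda>a. a * _"] cong: if_cong)
    then show ?thesis
      by (simp add: det_mul det_mat flip: power_mult) (simp add: mult.commute)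
  qed
  have inv: "matrix_inv \<Omega> *v (s *\<^sub>R z) = (1 / s) *\<^sub>R (matrix_inv \<Sigma> *v z)" for z
  proof (rule matrix_inv_mult_vec_eqI)
    show "invertible \<Omega>"
      using \<Sigma> s unfolding det_\<Omega> invertible_det_nz by simp
    show "\<Omega> *v ((1 / s) *\<^sub>R (matrix_inv \<Sigma> *v z)) = s *\<^sub>R z"
      using s \<Sigma>(1) by (simp add: \<Omega> scaleR_matrix_vector_assoc[symmetric] matrix_vector_mult_scaleR
          matrix_inv_mult_vec pos_def_invertible power2_eq_square)
  qed
  have det: "det \<Omega> powr (- (1/2)) = 1 / (s ^ CARD('n) * sqrt (det \<Sigma>))"
    using s \<Sigma>(2) by (simp add: det_\<Omega> powr_minus powr_half_sqrt real_sqrt_mult inverse_eq_divide)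
  \<comment> \<open>This is where the \<open>- I\<close> in the copula density comes from: at
    \<open>q = s z\<close> the form of \<open>\<Omega>^-1\<close> is that of
    \<open>\<Sigma>^-1\<close> at \<open>z\<close>, while the identity contributes
    \<open>s^2 (z \<bullet> z)\<close>, the exponent of the product law. The factor
    \<open>s^n\<close> from \<open>det \<Omega>\<close> cancels against the \<open>n\<close> normal
    densities of standard deviation \<open>1 / s\<close>.\<close>
  have dens: "mvn_density \<Sigma> z = (\<Prod>i\<in>UNIV. normal_density 0 (1 / s) (z $ i)) * h (R z)" for z
  proof -
    have "q (R z) \<bullet> ((matrix_inv \<Omega> - mat 1) *v q (R z)) = z \<bullet> (matrix_inv \<Sigma> *v z) - (s * s) * (z \<bullet> z)"
      using s by (simp add: qR matrix_vector_mult_diff_rdistrib inv inner_diff_right)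
    moreover have "(\<Prod>i\<in>UNIV. normal_density 0 (1 / s) (z $ i))
       = exp (- (1/2) * ((s * s) * (z \<bullet> z))) * (s ^ CARD('n) / sqrt ((2 * pi) ^ CARD('n)))"
      using mvn_density_mat[of "1 / s\<^sup>2" z] s
      by (simp add: mvn_density_def matrix_inv_mat_mult_vec det_mat real_sqrt_divide power_divide real_sqrt_mult
          power2_eq_square[of s] power_mult_distrib real_sqrt_power)
    ultimately show ?thesis
      using s \<Sigma>(2) by (simp add: mvn_density_def h_def det exp_add[symmetric] algebra_simps real_sqrt_mult)
  qed
  have h0: "h y \<ge> 0" for y by (simp add: h_def)
  have "mvn 0 \<Sigma> = density (density lborel (\<lambda>z. \<Prod>i\<in>UNIV. ennreal (normal_density 0 (1/s) (z $ i)))) (\<lambda>z. ennreal (h (R z)))"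
    by (subst density_density_eq) (auto simp: mvn_eq_density dens ennreal_mult'' h0 prod_ennreal)
  then have "distr (mvn 0 \<Sigma>) borel R
    = density (distr (density lborel (\<lambda>z. \<Prod>i\<in>UNIV. ennreal (normal_density 0 (1/s) (z $ i)))) borel R) (\<lambda>y. ennreal (h y))"
    by (simp add: density_distr)
  also have "distr (density lborel (\<lambda>z. \<Prod>i\<in>UNIV. ennreal (normal_density 0 (1/s) (z $ i)))) borel R
    = density lborel (\<lambda>y. \<Prod>i\<in>UNIV. ennreal (p (y $ i)))"
    unfolding R_def[abs_def]
  proof (rule distr_density_prod)
    show "(\<lambda>t. quantile F (std_normal_cdf (s * t))) \<in> borel_measurable borel" by measurable
    show "distr (density lborel (normal_density 0 (1/s))) borel (\<lambda>t. quantile F (std_normal_cdf (s * t))) = density lborel p"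
      unfolding F by (rule distr_quantile_scaled_normal[OF D s])
    show "prob_space (density lborel p)" by fact
  qed measurable
  also have "density \<dots> (\<lambda>y. ennreal (h y)) = gaussian_copula_law \<Omega> F p"
  proof -
    have "gaussian_copula_density \<Omega> F p y = (\<Prod>i\<in>UNIV. p (y $ i)) * h y" for y
      by (simp only: gaussian_copula_density_def Let_def h_def q_def mult.commute)
    then show ?thesis
      unfolding gaussian_copula_law_def
      by (subst density_density_eq) (simp_all add: prod_ennreal p0 ennreal_mult'' h0)
  qed
  finally show ?thesis unfolding R_def .
qed

section \<open>Optimality of componentwise monotone maps\<close>

lemma nn_integral_triangle:
  fixes a b :: real
  shows "(\<integral>\<^sup>+q. (if b \<le> fst q \<and> fst q \<le> snd q \<and> snd q \<le> a then 1 else 0) \<partial>(lborel \<Otimes>\<^sub>M lborel))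
    = ennreal (if b \<le> a then (a - b)\<^sup>2 / 2 else 0)"
proof -
  have "(\<integral>\<^sup>+q. (if b \<le> fst q \<and> fst q \<le> snd q \<and> snd q \<le> a then 1 else 0) \<partial>(lborel \<Otimes>\<^sub>M lborel))
    = (\<integral>\<^sup>+s. \<integral>\<^sup>+t. (if b \<le> s \<and> s \<le> t \<and> t \<le> a then 1 else 0) \<partial>lborel \<partial>lborel)"
  proof -
    let ?f = "\<lambda>q. (if b \<le> fst q \<and> fst q \<le> snd q \<and> snd q \<le> a then 1 else 0) :: ennreal"
    have "?f \<in> borel_measurable (lborel \<Otimes>\<^sub>M lborel)" by measurable
    from lborel.nn_integral_fst[OF this] show ?thesis by (simp only: fst_conv snd_conv)
  qed
  also have "\<dots> = (\<integral>\<^sup>+s. ennreal (a - s) * indicator {b..a} s \<partial>lborel)"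
  proof (rule nn_integral_cong)
    fix s
    have "(\<integral>\<^sup>+t. (if b \<le> s \<and> s \<le> t \<and> t \<le> a then 1 else 0) \<partial>lborel) = (\<integral>\<^sup>+t. indicator {b..a} s * indicator {s..a} t \<partial>lborel)"
      by (rule nn_integral_cong) (auto simp: indicator_def)
    also have "\<dots> = indicator {b..a} s * emeasure lborel {s..a}"
      by (simp add: nn_integral_cmult)
    also have "\<dots> = ennreal (a - s) * indicator {b..a} s"
      by (cases "s \<in> {b..a}") simp_all
    finally show "(\<integral>\<^sup>+t. (if b \<le> s \<and> s \<le> t \<and> t \<le> a then 1 else 0) \<partial>lborel) = \<dots>" .
  qed
  also have "\<dots> = ennreal (if b \<le> a then (a - b)\<^sup>2 / 2 else 0)"
  proof (cases "b \<le> a")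
    case True
    have "(\<integral>\<^sup>+s. ennreal (a - s) * indicator {b..a} s \<partial>lborel) = ennreal (- (a - a)\<^sup>2 / 2 - - (a - b)\<^sup>2 / 2)"
    proof (rule nn_integral_FTC_Icc[OF _ _ _ True])
      show "((\<lambda>s. - (a - s)\<^sup>2 / 2) has_real_derivative a - s) (at s)" for s
        by (auto intro!: derivative_eq_intros simp: diff_divide_distrib)
    qed auto
    then show ?thesis using True by simp
  qed simp
  finally show ?thesis .
qed

text \<open>Twice the area of the triangle between \<open>a\<close> and \<open>b\<close>. Integrating this over a coupling expresses the cost
  by probabilities \<open>P(W \<le> s, X \<ge> t)\<close> with values in \<open>[0, \<infinity>]\<close>, so no moments are needed.\<close>

lemma square_diff_eq_nn_integral:
  fixes a b :: real
  shows "ennreal ((a - b)\<^sup>2) = 2 * (\<integral>\<^sup>+q.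
      (if b \<le> fst q \<and> fst q \<le> snd q \<and> snd q \<le> a then 1 else 0) +
      (if a \<le> fst q \<and> fst q \<le> snd q \<and> snd q \<le> b then 1 else 0) \<partial>(lborel \<Otimes>\<^sub>M lborel))"
  by (subst nn_integral_add)
     (auto simp: nn_integral_triangle power2_commute[of a b] ennreal_plus[symmetric] ennreal_mult'[symmetric]
       ennreal_numeral[symmetric] simp del: ennreal_plus ennreal_numeral)

text \<open>Fubini turns the triangle indicators into probabilities. Writing
  \<open>\<not> X < t\<close> instead of \<open>t \<le> X\<close> exhibits each event as a
  difference of two events that involve one variable each, so their probabilities depend on the
  marginal laws only.\<close>

lemma nn_integral_square_diff:
  assumes "prob_space \<mu>" and [measurable]: "X \<in> borel_measurable \<mu>" "W \<in> borel_measurable \<mu>"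
  shows "(\<integral>\<^sup>+\<omega>. ennreal ((X \<omega> - W \<omega>)\<^sup>2) \<partial>\<mu>) = 2 * (\<integral>\<^sup>+q.
      (if fst q \<le> snd q then emeasure \<mu> {\<omega>\<in>space \<mu>. W \<omega> \<le> fst q \<and> \<not> X \<omega> < snd q}
         + emeasure \<mu> {\<omega>\<in>space \<mu>. X \<omega> \<le> fst q \<and> \<not> W \<omega> < snd q} else 0) \<partial>(lborel \<Otimes>\<^sub>M lborel))"
proof -
  interpret prob_space \<mu> by fact
  interpret Q: sigma_finite_measure "lborel \<Otimes>\<^sub>M lborel :: (real \<times> real) measure"
    unfolding lborel_prod by (rule sigma_finite_lborel)
  interpret pair_sigma_finite \<mu> "lborel \<Otimes>\<^sub>M lborel :: (real \<times> real) measure" ..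
  let ?k = "\<lambda>b a q. (if b \<le> fst q \<and> fst q \<le> snd q \<and> snd q \<le> a then 1 else 0) :: ennreal"
  have "(\<integral>\<^sup>+\<omega>. ennreal ((X \<omega> - W \<omega>)\<^sup>2) \<partial>\<mu>)
    = 2 * (\<integral>\<^sup>+\<omega>. \<integral>\<^sup>+q. ?k (W \<omega>) (X \<omega>) q + ?k (X \<omega>) (W \<omega>) q \<partial>(lborel \<Otimes>\<^sub>M lborel) \<partial>\<mu>)"
    by (simp only: square_diff_eq_nn_integral) (rule nn_integral_cmult, measurable)
  also have "(\<integral>\<^sup>+\<omega>. \<integral>\<^sup>+q. ?k (W \<omega>) (X \<omega>) q + ?k (X \<omega>) (W \<omega>) q \<partial>(lborel \<Otimes>\<^sub>M lborel) \<partial>\<mu>)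
    = (\<integral>\<^sup>+q. \<integral>\<^sup>+\<omega>. ?k (W \<omega>) (X \<omega>) q + ?k (X \<omega>) (W \<omega>) q \<partial>\<mu> \<partial>(lborel \<Otimes>\<^sub>M lborel))"
    by (rule Fubini'[symmetric]) measurable
  also have "\<dots> = (\<integral>\<^sup>+q.
      (if fst q \<le> snd q then emeasure \<mu> {\<omega>\<in>space \<mu>. W \<omega> \<le> fst q \<and> \<not> X \<omega> < snd q}
         + emeasure \<mu> {\<omega>\<in>space \<mu>. X \<omega> \<le> fst q \<and> \<not> W \<omega> < snd q} else 0) \<partial>(lborel \<Otimes>\<^sub>M lborel))"
  proof (rule nn_integral_cong)
    fix q :: "real \<times> real"
    have k: "(\<integral>\<^sup>+\<omega>. ?k (A \<omega>) (B \<omega>) q \<partial>\<mu>)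
        = (if fst q \<le> snd q then emeasure \<mu> {\<omega>\<in>space \<mu>. A \<omega> \<le> fst q \<and> \<not> B \<omega> < snd q} else 0)"
      if [measurable]: "A \<in> borel_measurable \<mu>" "B \<in> borel_measurable \<mu>" for A B
    proof (cases "fst q \<le> snd q")
      case True
      have "(\<integral>\<^sup>+\<omega>. ?k (A \<omega>) (B \<omega>) q \<partial>\<mu>)
        = (\<integral>\<^sup>+\<omega>. indicator {\<omega>\<in>space \<mu>. A \<omega> \<le> fst q \<and> \<not> B \<omega> < snd q} \<omega> \<partial>\<mu>)"
        using True by (intro nn_integral_cong) (auto simp: indicator_def)
      also have "\<dots> = emeasure \<mu> {\<omega>\<in>space \<mu>. A \<omega> \<le> fst q \<and> \<not> B \<omega> < snd q}"
        by (rule nn_integral_indicator) measurable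
      finally show ?thesis using True by simp
    qed auto
    show "(\<integral>\<^sup>+\<omega>. ?k (W \<omega>) (X \<omega>) q + ?k (X \<omega>) (W \<omega>) q \<partial>\<mu>)
      = (if fst q \<le> snd q then emeasure \<mu> {\<omega>\<in>space \<mu>. W \<omega> \<le> fst q \<and> \<not> X \<omega> < snd q}
         + emeasure \<mu> {\<omega>\<in>space \<mu>. X \<omega> \<le> fst q \<and> \<not> W \<omega> < snd q} else 0)"
      by (subst nn_integral_add) (simp_all add: k)
  qed
  finally show ?thesis .
qed

text \<open>Subadditivity bounds the measure of any difference below by the truncated difference of
  the measures; for nested sets this bound is attained.\<close>

lemma emeasure_diff_nested_le:
  assumes A: "A \<in> sets \<mu>" and A': "A' \<in> sets \<mu>" and B: "B \<in> sets \<mu>" and B': "B' \<in> sets \<mu>"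
    and fin: "finite_measure \<mu>"
    and eq: "emeasure \<mu> A = emeasure \<mu> A'" "emeasure \<mu> B = emeasure \<mu> B'"
    and nested: "A \<subseteq> B \<or> B \<subseteq> A"
  shows "emeasure \<mu> (A - B) \<le> emeasure \<mu> (A' - B')"
proof (cases "A \<subseteq> B")
  case True
  then have "emeasure \<mu> (A - B) = 0" by (metis Diff_eq_empty_iff emeasure_empty)
  then show ?thesis by simp
next
  case False
  interpret finite_measure \<mu> by fact
  from False nested have "emeasure \<mu> (A - B) = emeasure \<mu> A - emeasure \<mu> B"
    using A B by (intro emeasure_Diff) auto
  also have "\<dots> \<le> emeasure \<mu> (A' - B')"
  proof -
    have "emeasure \<mu> A' \<le> emeasure \<mu> ((A' - B') \<union> B')"
      using A' B' by (intro emeasure_mono) auto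
    also have "\<dots> \<le> emeasure \<mu> (A' - B') + emeasure \<mu> B'"
      using A' B' by (intro emeasure_subadditive) auto
    finally show ?thesis
      unfolding eq by (simp add: ennreal_minus_le_iff add.commute)
  qed
  finally show ?thesis .
qed

text \<open>\<open>P(W \<le> s, X \<ge> t) \<ge> P(W \<le> s) - P(X < t)\<close> always, and the positive part of the right-hand side is attained
  when the two events are nested, as they are for \<open>W = r(X)\<close>.\<close>

lemma monotone_rearrangement_cost_le:
  assumes "prob_space \<mu>" and [measurable]: "X \<in> borel_measurable \<mu>" "W \<in> borel_measurable \<mu>"
    and r: "mono (r :: real \<Rightarrow> real)"
    and law: "distr \<mu> borel W = distr \<mu> borel (\<lambda>\<omega>. r (X \<omega>))"
  shows "(\<integral>\<^sup>+\<omega>. ennreal ((X \<omega> - r (X \<omega>))\<^sup>2) \<partial>\<mu>) \<le> (\<integral>\<^sup>+\<omega>. ennreal ((X \<omega> - W \<omega>)\<^sup>2) \<partial>\<mu>)"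
proof -
  interpret prob_space \<mu> by fact
  have r_meas[measurable]: "r \<in> borel_measurable borel" by (rule borel_measurable_mono[OF r])
  have law': "emeasure \<mu> {\<omega>\<in>space \<mu>. r (X \<omega>) \<in> S} = emeasure \<mu> {\<omega>\<in>space \<mu>. W \<omega> \<in> S}"
    if [measurable]: "S \<in> sets borel" for S
  proof -
    have "emeasure (distr \<mu> borel W) S = emeasure (distr \<mu> borel (\<lambda>\<omega>. r (X \<omega>))) S"
      by (simp add: law)
    moreover have "(\<lambda>\<omega>. r (X \<omega>)) -` S \<inter> space \<mu> = {\<omega>\<in>space \<mu>. r (X \<omega>) \<in> S}"
      "W -` S \<inter> space \<mu> = {\<omega>\<in>space \<mu>. W \<omega> \<in> S}" by auto
    ultimately show ?thesis by (simp add: emeasure_distr)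
  qed
  have le: "emeasure \<mu> {\<omega>\<in>space \<mu>. r (X \<omega>) \<le> s} = emeasure \<mu> {\<omega>\<in>space \<mu>. W \<omega> \<le> s}" for s
    using law'[of "{..s}"] by simp
  have less: "emeasure \<mu> {\<omega>\<in>space \<mu>. r (X \<omega>) < t} = emeasure \<mu> {\<omega>\<in>space \<mu>. W \<omega> < t}" for t
    using law'[of "{..<t}"] by simp
  have diff: "{\<omega>\<in>space \<mu>. P \<omega> \<and> \<not> Q \<omega>} = {\<omega>\<in>space \<mu>. P \<omega>} - {\<omega>\<in>space \<mu>. Q \<omega>}" for P Q by auto
  have 1: "emeasure \<mu> {\<omega>\<in>space \<mu>. r (X \<omega>) \<le> s \<and> \<not> X \<omega> < t} \<le> emeasure \<mu> {\<omega>\<in>space \<mu>. W \<omega> \<le> s \<and> \<not> X \<omega> < t}" for s t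
    unfolding diff
  proof (rule emeasure_diff_nested_le)
    show "{\<omega>\<in>space \<mu>. r (X \<omega>) \<le> s} \<subseteq> {\<omega>\<in>space \<mu>. X \<omega> < t} \<or> {\<omega>\<in>space \<mu>. X \<omega> < t} \<subseteq> {\<omega>\<in>space \<mu>. r (X \<omega>) \<le> s}"
    \<comment> \<open>The value of \<open>r\<close> at the threshold \<open>t\<close> decides the
      inclusion: if \<open>r t \<le> s\<close>, then \<open>X < t\<close> implies
      \<open>r X \<le> r t \<le> s\<close>; otherwise \<open>r X \<le> s < r t\<close> forces
      \<open>X < t\<close>.\<close>
    proof (cases "r t \<le> s")
      case True
      then have "{\<omega>\<in>space \<mu>. X \<omega> < t} \<subseteq> {\<omega>\<in>space \<mu>. r (X \<omega>) \<le> s}"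
        using monoD[OF r] by (blast intro: order_trans less_imp_le)
      then show ?thesis ..
    next
      case False
      then have "{\<omega>\<in>space \<mu>. r (X \<omega>) \<le> s} \<subseteq> {\<omega>\<in>space \<mu>. X \<omega> < t}"
        using monoD[OF r] by (blast intro: order_trans not_le_imp_less)
      then show ?thesis ..
    qed
  qed (auto simp: le finite_measure_axioms)
  have 2: "emeasure \<mu> {\<omega>\<in>space \<mu>. X \<omega> \<le> s \<and> \<not> r (X \<omega>) < t} \<le> emeasure \<mu> {\<omega>\<in>space \<mu>. X \<omega> \<le> s \<and> \<not> W \<omega> < t}" for s t
    unfolding diff
  proof (rule emeasure_diff_nested_le)
    show "{\<omega>\<in>space \<mu>. X \<omega> \<le> s} \<subseteq> {\<omega>\<in>space \<mu>. r (X \<omega>) < t} \<or> {\<omega>\<in>space \<mu>. r (X \<omega>) < t} \<subseteq> {\<omega>\<in>space \<mu>. X \<omega> \<le> s}"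
    proof (cases "r s < t")
      case True
      then have "{\<omega>\<in>space \<mu>. X \<omega> \<le> s} \<subseteq> {\<omega>\<in>space \<mu>. r (X \<omega>) < t}"
        using monoD[OF r] by (blast intro: le_less_trans)
      then show ?thesis ..
    next
      case False
      then have "{\<omega>\<in>space \<mu>. r (X \<omega>) < t} \<subseteq> {\<omega>\<in>space \<mu>. X \<omega> \<le> s}"
        using monoD[OF r] by (blast intro: le_less_trans less_imp_le not_le_imp_less)
      then show ?thesis ..
    qed
  qed (auto simp: less finite_measure_axioms)
  have "(\<integral>\<^sup>+\<omega>. ennreal ((X \<omega> - r (X \<omega>))\<^sup>2) \<partial>\<mu>) = 2 * (\<integral>\<^sup>+q.
      (if fst q \<le> snd q then emeasure \<mu> {\<omega>\<in>space \<mu>. r (X \<omega>) \<le> fst q \<and> \<not> X \<omega> < snd q}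
         + emeasure \<mu> {\<omega>\<in>space \<mu>. X \<omega> \<le> fst q \<and> \<not> r (X \<omega>) < snd q} else 0) \<partial>(lborel \<Otimes>\<^sub>M lborel))"
    by (rule nn_integral_square_diff) (use \<open>prob_space \<mu>\<close> in auto)
  also have "\<dots> \<le> 2 * (\<integral>\<^sup>+q.
      (if fst q \<le> snd q then emeasure \<mu> {\<omega>\<in>space \<mu>. W \<omega> \<le> fst q \<and> \<not> X \<omega> < snd q}
         + emeasure \<mu> {\<omega>\<in>space \<mu>. X \<omega> \<le> fst q \<and> \<not> W \<omega> < snd q} else 0) \<partial>(lborel \<Otimes>\<^sub>M lborel))"
    by (intro mult_left_mono nn_integral_mono) (auto intro!: add_mono 1 2)
  also have "\<dots> = (\<integral>\<^sup>+\<omega>. ennreal ((X \<omega> - W \<omega>)\<^sup>2) \<partial>\<mu>)"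
    by (rule nn_integral_square_diff[symmetric]) (use \<open>prob_space \<mu>\<close> in auto)
  finally show ?thesis .
qed

text \<open>A coordinate of a competitor \<open>T\<close> may depend on all of \<open>z\<close>, but
  only its law enters the one-dimensional bound. The map built from \<open>r\<close> attains all
  these bounds simultaneously, so the dependence between coordinates does not matter.\<close>

lemma optimal_transport_map_componentwise_mono:
  fixes \<mu> \<nu> :: "(real ^ 'n) measure" and r :: "real \<Rightarrow> real"
  assumes \<mu>: "prob_space \<mu>" and sets[measurable_cong]: "sets \<mu> = sets borel"
    and r: "mono r" and R: "transport_map \<mu> \<nu> (\<lambda>z. \<chi> i. r (z $ i))"
  shows "optimal_transport_map \<mu> \<nu> (\<lambda>z. \<chi> i. r (z $ i))"
  unfolding optimal_transport_map_def
proof (intro conjI allI impI R)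
  fix T assume T: "transport_map \<mu> \<nu> T"
  let ?R = "\<lambda>z :: real ^ 'n. \<chi> i. r (z $ i)"
  have [measurable]: "T \<in> borel_measurable borel" "?R \<in> borel_measurable borel"
    using T R by (auto simp: transport_map_def)
  have [measurable]: "r \<in> borel_measurable borel" by (rule borel_measurable_mono[OF r])
  have cost: "(\<integral>\<^sup>+z. ennreal ((norm (z - S z))\<^sup>2) \<partial>\<mu>) = (\<Sum>i\<in>UNIV. \<integral>\<^sup>+z. ennreal ((z $ i - S z $ i)\<^sup>2) \<partial>\<mu>)"
    if [measurable]: "S \<in> borel_measurable borel" for S
  proof -
    have "(norm (z - S z))\<^sup>2 = (\<Sum>i\<in>UNIV. (z $ i - S z $ i)\<^sup>2)" for z
      unfolding power2_norm_eq_inner inner_vec_def by (simp add: power2_eq_square)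
    then have "(\<integral>\<^sup>+z. ennreal ((norm (z - S z))\<^sup>2) \<partial>\<mu>)
       = (\<integral>\<^sup>+z. (\<Sum>i\<in>UNIV. ennreal ((z $ i - S z $ i)\<^sup>2)) \<partial>\<mu>)"
      by (simp add: sum_ennreal)
    also have "\<dots> = (\<Sum>i\<in>UNIV. \<integral>\<^sup>+z. ennreal ((z $ i - S z $ i)\<^sup>2) \<partial>\<mu>)"
      by (rule nn_integral_sum) measurable
    finally show ?thesis .
  qed
  have "(\<integral>\<^sup>+z. ennreal ((z $ i - r (z $ i))\<^sup>2) \<partial>\<mu>) \<le> (\<integral>\<^sup>+z. ennreal ((z $ i - T z $ i)\<^sup>2) \<partial>\<mu>)" for i
  proof (rule monotone_rearrangement_cost_le[OF \<mu> _ _ r])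
    have "distr (distr \<mu> borel T) borel (\<lambda>y. y $ i) = distr (distr \<mu> borel ?R) borel (\<lambda>y. y $ i)"
      using T R by (simp add: transport_map_def)
    then show "distr \<mu> borel (\<lambda>z. T z $ i) = distr \<mu> borel (\<lambda>z. r (z $ i))"
      by (simp add: distr_distr comp_def)
  qed measurable
  then show "(\<integral>\<^sup>+z. ennreal ((norm (z - ?R z))\<^sup>2) \<partial>\<mu>) \<le> (\<integral>\<^sup>+z. ennreal ((norm (z - T z))\<^sup>2) \<partial>\<mu>)"
    by (simp add: cost sum_mono)
qed

section \<open>Conditional laws\<close>

text \<open>Countability lets the exceptional null sets, one for each generating set, be united when
  two conditional laws are compared.\<close>

lemma borel_countable_Int_stable_generator:
  obtains G :: "'a::second_countable_topology set set"
  where "countable G" "Int_stable G" "UNIV \<in> G" "sets borel = sigma_sets UNIV G"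
proof -
  obtain B :: "'a set set" where B: "countable B" "topological_basis B"
    using ex_countable_basis by blast
  \<comment> \<open>The empty family is included on purpose: its intersection is
    \<open>UNIV\<close>, which serves as the exhausting set of finite measure.\<close>
  define G where "G = Inter ` {F. finite F \<and> F \<subseteq> B}"
  have "countable G"
    unfolding G_def using B(1) by (intro countable_image countable_Collect_finite_subset)
  moreover have "Int_stable G"
  proof (rule Int_stableI)
    fix a b assume "a \<in> G" "b \<in> G"
    then obtain F F' where "finite F" "F \<subseteq> B" "a = \<Inter> F" "finite F'" "F' \<subseteq> B" "b = \<Inter> F'"
      by (auto simp: G_def)
    then have "a \<inter> b = \<Inter> (F \<union> F')" "F \<union> F' \<in> {F. finite F \<and> F \<subseteq> B}" by auto
    then show "a \<inter> b \<in> G" unfolding G_def by (rule image_eqI)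
  qed
  moreover have "\<Inter> {} \<in> G" unfolding G_def by (intro imageI) simp
  then have "UNIV \<in> G" by simp
  moreover have "sets borel = sigma_sets UNIV G"
  proof
    have "B \<subseteq> G"
    proof
      fix b assume "b \<in> B"
      then have "\<Inter> {b} \<in> G" unfolding G_def by (intro imageI) simp
      then show "b \<in> G" by simp
    qed
    then show "sets borel \<subseteq> sigma_sets UNIV G"
      unfolding borel_eq_countable_basis[OF B] by (simp add: sigma_sets_mono')
    have "open g" if "g \<in> G" for g
      using that topological_basis_open[OF B(2)] unfolding G_def by (blast intro: open_Inter)
    then show "sigma_sets UNIV G \<subseteq> sets borel"
      using sets.sigma_sets_subset[of G borel] by (simp add: subsetI borel_open)
  qed
  ultimately show thesis by (rule that)
qed

text \<open>For a fixed event both kernels are densities of the same measure, hence equal almost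
  everywhere. This is applied to a countable generator stable under intersection, which determines a
  probability measure.\<close>

lemma conditional_law_unique:
  fixes U :: "'w \<Rightarrow> 'a::topological_space" and V :: "'w \<Rightarrow> 'b::second_countable_topology"
  assumes "prob_space P" and U: "U \<in> borel_measurable P"
    and \<kappa>: "conditional_law P U V \<kappa>" and \<kappa>': "conditional_law P U V \<kappa>'"
  shows "AE u in distr P borel U. \<kappa> u = \<kappa>' u"
proof -
  interpret prob_space P by fact
  interpret D: prob_space "distr P borel U" by (rule prob_space_distr[OF U])
  obtain G :: "'b set set" where G: "countable G" "Int_stable G" "UNIV \<in> G" "sets borel = sigma_sets UNIV G"
    by (rule borel_countable_Int_stable_generator)
  have meas: "(\<lambda>u. emeasure (\<eta> u) g) \<in> borel_measurable borel"
    if "conditional_law P U V \<eta>" "g \<in> sets borel" for \<eta> g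
    using that by (intro measurable_compose[OF _ measurable_emeasure_subprob_algebra])
      (auto simp: conditional_law_def intro: measurable_prob_algebraD)
  have "AE u in distr P borel U. \<forall>g\<in>G. emeasure (\<kappa> u) g = emeasure (\<kappa>' u) g"
    unfolding AE_ball_countable[OF G(1)]
  proof
    fix g assume "g \<in> G"
    then have g: "g \<in> sets borel" by (simp add: G(4))
    show "AE u in distr P borel U. emeasure (\<kappa> u) g = emeasure (\<kappa>' u) g"
    proof (rule D.density_unique2)
      fix A assume "A \<in> sets (distr P borel U)"
      then have A: "A \<in> sets borel" by simp
      show "(\<integral>\<^sup>+u\<in>A. emeasure (\<kappa> u) g \<partial>distr P borel U) = (\<integral>\<^sup>+u\<in>A. emeasure (\<kappa>' u) g \<partial>distr P borel U)"
        using \<kappa>[unfolded conditional_law_def, THEN conjunct2, rule_format, OF A g]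
          \<kappa>'[unfolded conditional_law_def, THEN conjunct2, rule_format, OF A g] by (rule trans[OF sym])
    qed (use meas[OF \<kappa> g] meas[OF \<kappa>' g] in auto)
  qed
  then show ?thesis
  proof eventually_elim
    case (elim u)
    have sets: "sets (\<eta> u) = sigma_sets UNIV G" and fin: "prob_space (\<eta> u)" if "conditional_law P U V \<eta>" for \<eta>
    proof -
      have "\<eta> u \<in> space (prob_algebra borel)"
        using that by (auto simp: conditional_law_def dest: measurable_space)
      then show "sets (\<eta> u) = sigma_sets UNIV G" "prob_space (\<eta> u)"
        by (simp_all add: space_prob_algebra G(4))
    qed
    show ?case
    proof (rule measure_eqI_generator_eq_countable[OF G(2), where A="{UNIV}"])
      show "emeasure (\<kappa> u) a \<noteq> \<infinity>" if "a \<in> {UNIV}" for a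
        using finite_measure.emeasure_finite[OF prob_space.finite_measure[OF fin[OF \<kappa>]]] by simp
      show "sets (\<kappa> u) = sigma_sets UNIV G" "sets (\<kappa>' u) = sigma_sets UNIV G"
        by (rule sets[OF \<kappa>] sets[OF \<kappa>'])+
    qed (use elim G(3) in auto)
  qed
qed

text \<open>An almost sure change of \<open>W\<close> leaves its joint law with \<open>U\<close>
  unchanged, so \<open>W\<close> may be replaced by \<open>f (V \<omega>)\<close>, whose events are
  events of \<open>V\<close>.\<close>

lemma conditional_law_map:
  fixes U :: "'w \<Rightarrow> 'a::topological_space" and V W :: "'w \<Rightarrow> 'b::topological_space"
  assumes \<kappa>: "conditional_law P U V \<kappa>"
    and f[measurable]: "f \<in> borel_measurable borel"
    and U[measurable]: "U \<in> borel_measurable P" and V[measurable]: "V \<in> borel_measurable P"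
    and W[measurable]: "W \<in> borel_measurable P" and AE: "AE \<omega> in P. W \<omega> = f (V \<omega>)"
  shows "conditional_law P U W (\<lambda>u. distr (\<kappa> u) borel f)"
  unfolding conditional_law_def
proof (intro conjI ballI)
  have k: "\<kappa> \<in> borel \<rightarrow>\<^sub>M prob_algebra borel" using \<kappa> by (simp add: conditional_law_def)
  then show "(\<lambda>u. distr (\<kappa> u) borel f) \<in> borel \<rightarrow>\<^sub>M prob_algebra borel"
    by (rule measurable_compose[OF _ measurable_distr_prob_space[OF f]])
  fix A :: "'a set" and B :: "'b set" assume A[measurable]: "A \<in> sets borel" and B[measurable]: "B \<in> sets borel"
  have sets: "sets (\<kappa> u) = sets borel" for u
    using measurable_space[OF k, of u] by (simp add: space_prob_algebra)
  then have push: "emeasure (distr (\<kappa> u) borel f) B = emeasure (\<kappa> u) (f -` B)" for u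
  proof (subst emeasure_distr)
    have "space (\<kappa> u) = UNIV" using sets_eq_imp_space_eq[OF sets] by simp
    then show "emeasure (\<kappa> u) (f -` B \<inter> space (\<kappa> u)) = emeasure (\<kappa> u) (f -` B)" by simp
    show "f \<in> \<kappa> u \<rightarrow>\<^sub>M borel" using f by (simp only: measurable_cong_sets[OF sets refl])
  qed (rule B)
  have fB: "f -` B \<in> sets borel" using measurable_sets[OF f B] by simp
  have "emeasure P {\<omega> \<in> space P. U \<omega> \<in> A \<and> W \<omega> \<in> B} = emeasure P {\<omega> \<in> space P. U \<omega> \<in> A \<and> f (V \<omega>) \<in> B}"
    using AE by (intro emeasure_eq_AE) auto
  also have "\<dots> = (\<integral>\<^sup>+u\<in>A. emeasure (\<kappa> u) (f -` B) \<partial>distr P borel U)"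
    using \<kappa>[unfolded conditional_law_def, THEN conjunct2, rule_format, OF A fB] by simp
  finally show "emeasure P {\<omega> \<in> space P. U \<omega> \<in> A \<and> W \<omega> \<in> B} = (\<integral>\<^sup>+u\<in>A. emeasure (distr (\<kappa> u) borel f) B \<partial>distr P borel U)"
    by (simp add: push)
qed

section \<open>The transport map of the copula process\<close>

lemma mono_quantile_std_normal:
  assumes D: "real_distribution D" and s: "s > 0"
  shows "mono (\<lambda>t. quantile (cdf D) (std_normal_cdf (s * t)))"
proof (rule monoI)
  fix t t' :: real assume "t \<le> t'"
  then have "std_normal_cdf (s * t) \<le> std_normal_cdf (s * t')"
    using s by (simp add: std_normal_cdf_mono_iff)
  also have "\<dots> \<le> cdf D (quantile (cdf D) (std_normal_cdf (s * t')))"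
    using quantile_le_iff[OF D std_normal_cdf_bounds] by blast
  finally show "quantile (cdf D) (std_normal_cdf (s * t)) \<le> quantile (cdf D) (std_normal_cdf (s * t'))"
    by (simp add: quantile_le_iff[OF D std_normal_cdf_bounds])
qed

lemma quantile_std_normal_has_real_derivative:
  assumes D: "real_distribution D" and cont: "\<And>y. isCont (cdf D) y"
    and der: "(cdf D has_real_derivative f) (at (quantile (cdf D) (std_normal_cdf (s * t))))" and f: "f > 0"
  shows "((\<lambda>t. quantile (cdf D) (std_normal_cdf (s * t))) has_real_derivative s * std_normal_density (s * t) / f) (at t)"
proof -
  have "((\<lambda>t. s * t) has_real_derivative s) (at t)"
    using DERIV_cmult_Id[of s t UNIV] by simp
  from DERIV_chain2[OF std_normal_cdf_DERIV this]
  have "((\<lambda>t. std_normal_cdf (s * t)) has_real_derivative std_normal_density (s * t) * s) (at t)" .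
  from DERIV_chain2[OF quantile_has_real_derivative[OF D cont std_normal_cdf_bounds der f] this]
  show ?thesis by (simp add: field_simps)
qed

lemma det_jacobian_componentwise:
  fixes r :: "real \<Rightarrow> real" and z :: "real ^ 'n"
  assumes "\<And>i. (r has_real_derivative d i) (at (z $ i))"
  shows "(\<lambda>z. \<chi> i. r (z $ i)) differentiable (at z)"
    and "det (jacobian (\<lambda>z. \<chi> i. r (z $ i)) (at z)) = (\<Prod>i\<in>UNIV. d i)"
proof -
  let ?R = "\<lambda>z :: real ^ 'n. \<chi> i. r (z $ i)"
  let ?R' = "\<lambda>h :: real ^ 'n. \<chi> i. d i * h $ i"
  have der: "(?R has_derivative ?R') (at z)"
  proof (subst has_derivative_componentwise_within, rule ballI)
    fix b :: "real ^ 'n" assume "b \<in> Basis"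
    then obtain i where b: "b = axis i 1" by (auto simp: Basis_vec_def)
    have "(r has_derivative (\<lambda>h. d i * h)) (at (z $ i))"
      using assms[of i] by (simp add: has_field_derivative_def)
    then have "((\<lambda>z. r (z $ i)) has_derivative (\<lambda>h. d i * h $ i)) (at z)"
      by (rule has_derivative_compose[of "\<lambda>z. z $ i" "\<lambda>h. h $ i", rotated])
         (rule bounded_linear_imp_has_derivative bounded_linear_vec_nth)+
    then show "((\<lambda>x. ?R x \<bullet> b) has_derivative (\<lambda>x. ?R' x \<bullet> b)) (at z)"
      by (simp add: b inner_axis)
  qed
  then show "?R differentiable (at z)" by (auto simp: differentiable_def)
  have "jacobian ?R (at z) = matrix ?R'"
    unfolding jacobian_def by (simp flip: frechet_derivative_at[OF der])
  moreover have "det (matrix ?R') = (\<Prod>i\<in>UNIV. d i)"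
    by (subst det_diagonal) (auto simp: matrix_def axis_def)
  ultimately show "det (jacobian ?R (at z)) = (\<Prod>i\<in>UNIV. d i)" by simp
qed

lemma eq_quantile:
  assumes D: "real_distribution D" and cont: "\<And>y. isCont (cdf D) y"
    and u: "0 < u" "u < 1" and y: "cdf D y = u" and nonflat: "u \<notin> cdf D ` \<rat>"
  shows "y = quantile (cdf D) u"
proof (rule ccontr)
  assume "y \<noteq> quantile (cdf D) u"
  moreover have "quantile (cdf D) u \<le> y" using quantile_le_iff[OF D u, of y] y by simp
  ultimately obtain q where q: "q \<in> \<rat>" "quantile (cdf D) u < q" "q < y"
    using Rats_dense_in_real[of "quantile (cdf D) u" y] by auto
  interpret real_distribution D by fact
  have "u \<le> cdf D q" using quantile_le_iff[OF D u, of q] q(2) by simp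
  moreover have "cdf D q \<le> u" using cdf_nondecreasing[of q y] q(3) y by simp
  ultimately show False using nonflat q(1) by auto
qed

text \<open>The hyperplanes \<open>z $ i = t\<close> with \<open>t\<close> in \<open>N\<close> form
  a countable family of Lebesgue null sets, and \<open>mvn\<close> has a density.\<close>

lemma AE_mvn_component_notin_countable:
  fixes \<mu> :: "real ^ 'n"
  assumes "countable N"
  shows "AE z in mvn \<mu> \<Sigma>. \<forall>i. z $ i \<notin> N"
proof -
  have "AE z :: real ^ 'n in lborel. z $ i \<noteq> t" for i t
    using AE_lborel_inner_neq[of "axis i 1 :: real ^ 'n" t] by (simp add: inner_axis)
  then have "AE z :: real ^ 'n in lborel. \<forall>t\<in>N. z $ i \<noteq> t" for i
    by (subst AE_ball_countable[OF assms]) auto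
  then have "AE z :: real ^ 'n in lborel. \<forall>i\<in>UNIV. \<forall>t\<in>N. z $ i \<noteq> t"
    by (subst AE_ball_countable) auto
  then show ?thesis
    unfolding mvn_eq_density by (subst AE_density) (auto elim: eventually_mono)
qed

lemma distr_conditional_mvn:
  fixes E :: "real ^ 'l ^ 'n"
  assumes c: "c > 0" and Z: "Z \<in> borel_measurable P" and M: "distr P borel M = mvn 0 (mat c)"
    and cond: "conditional_law P M Z (\<lambda>\<mu>. mvn (E *v \<mu>) (mat 1))"
  shows "distr P borel Z = mvn 0 (c *\<^sub>R (E ** transpose E) + mat 1)"
proof (rule measure_eqI)
  show "sets (distr P borel Z) = sets (mvn 0 (c *\<^sub>R (E ** transpose E) + mat 1))" by (simp add: mvn_def)
  fix B assume "B \<in> sets (distr P borel Z)"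
  then have B: "B \<in> sets borel" by simp
  have "emeasure (distr P borel Z) B = emeasure P {\<omega> \<in> space P. M \<omega> \<in> UNIV \<and> Z \<omega> \<in> B}"
    using Z B by (subst emeasure_distr) (auto intro!: arg_cong[where f="emeasure P"])
  also have "\<dots> = (\<integral>\<^sup>+\<mu>\<in>UNIV. emeasure (mvn (E *v \<mu>) (mat 1)) B \<partial>distr P borel M)"
    using cond[unfolded conditional_law_def, THEN conjunct2, rule_format, OF _ B, of UNIV] by simp
  also have "\<dots> = emeasure (mvn 0 (c *\<^sub>R (E ** transpose E) + mat 1)) B"
    unfolding M using mvn_mixture[OF c B, of E] by simp
  finally show "emeasure (distr P borel Z) B = emeasure (mvn 0 (c *\<^sub>R (E ** transpose E) + mat 1)) B" .
qed

text \<open>A conditional law given \<open>M\<close> is determined only up to null sets of the law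
  of \<open>M\<close>. Claim (ii) therefore has two halves: the image kernel is a version of the
  conditional law of \<open>Y\<close>, and \<open>R\<close> transports to every version almost
  everywhere.\<close>

theorem proposition1:
  fixes c s :: real
    and m :: nat and K :: "nat \<Rightarrow> nat" and T :: "nat \<Rightarrow> nat \<Rightarrow> (real ^ 'p) set"
    and leaf :: "'l::finite \<Rightarrow> nat \<times> nat"
    and x :: "'n::finite \<Rightarrow> real ^ 'p"
    and F p :: "real \<Rightarrow> real"
    and E :: "real ^ 'l ^ 'n" and \<Omega> :: "real ^ 'n ^ 'n"
    and P :: "'w measure"
    and M :: "'w \<Rightarrow> real ^ 'l" and Z Y :: "'w \<Rightarrow> real ^ 'n"
    and R :: "real ^ 'n \<Rightarrow> real ^ 'n"
  assumes "c > 0"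
    and "tree_ensemble m K T" and "stacking m K leaf"
    and "\<And>i. x i \<in> cbox 0 1"
    and "s = (1 + real m * c) powr (- (1/2))"
    and "E = leaf_matrix T leaf x"
    and "\<Omega> = s\<^sup>2 *\<^sub>R (c *\<^sub>R (E ** transpose E) + mat 1)"
    \<comment> \<open>the distribution function and its density\<close>
    and "p \<in> borel_measurable borel" and "\<And>y. p y \<ge> 0"
    and "prob_space (density lborel p)" and "F = cdf (density lborel p)"
    and "\<And>y. p y > 0 \<Longrightarrow> (F has_real_derivative p y) (at y)"
    \<comment> \<open>the joint law of the random vectors\<close>
    and "prob_space P"
    and "M \<in> borel_measurable P" and "Z \<in> borel_measurable P" and "Y \<in> borel_measurable P"
    and "distr P borel M = mvn 0 (mat c)"
    and "conditional_law P M Z (\<lambda>\<mu>. mvn (E *v \<mu>) (mat 1))"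
    and "AE \<omega> in P. \<forall>i. F (Y \<omega> $ i) = std_normal_cdf (s * Z \<omega> $ i)"
    \<comment> \<open>the transport map\<close>
    and "R = (\<lambda>z. \<chi> i. quantile F (std_normal_cdf (s * z $ i)))"
  shows
    "(\<forall>z. (\<forall>i. p (R z $ i) > 0) \<longrightarrow>
        R differentiable (at z) \<and>
        det (jacobian R (at z)) = (\<Prod>i\<in>UNIV. s * std_normal_density (s * z $ i) / p (R z $ i)))
     \<and> (distr P borel Y = gaussian_copula_law \<Omega> F p
        \<and> optimal_transport_map (distr P borel Z) (gaussian_copula_law \<Omega> F p) R)
     \<and> (conditional_law P M Y (\<lambda>\<mu>. distr (mvn (E *v \<mu>) (mat 1)) borel R)
        \<and> (\<forall>\<kappa>. conditional_law P M Y \<kappa> \<longrightarrow>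
              (AE \<mu> in distr P borel M. transport_map (mvn (E *v \<mu>) (mat 1)) (\<kappa> \<mu>) R)))"
proof -
  define \<Sigma> where "\<Sigma> = c *\<^sub>R (E ** transpose E) + mat 1"
  define D where "D = density lborel (\<lambda>y. ennreal (p y))"
  define r where "r t = quantile F (std_normal_cdf (s * t))" for t
  have D: "real_distribution D" unfolding D_def by (rule real_distribution_density) fact
  have F: "F = cdf D" using assms(11) by (simp add: D_def)
  have cont: "isCont (cdf D) y" for y
    unfolding D_def by (rule isCont_cdf_density) (use assms(8,10) in auto)
  have "1 + real m * c > 0" using assms(1) by (intro add_pos_nonneg) auto
  then have s: "s > 0" unfolding assms(5) by (subst powr_gt_zero) simp
  have mono: "mono r" unfolding r_def[abs_def] F by (rule mono_quantile_std_normal[OF D s])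
  have R: "R = (\<lambda>z. \<chi> i. r (z $ i))" using assms(20) by (simp add: r_def)
  have R_meas: "R \<in> borel_measurable borel"
    unfolding R by (rule borel_measurable_vec_componentwise[OF borel_measurable_mono[OF mono]])
  have Z_law: "distr P borel Z = mvn 0 \<Sigma>"
    unfolding \<Sigma>_def by (rule distr_conditional_mvn[OF assms(1,15,17,18)])
  have \<Sigma>: "pos_def \<Sigma>" "0 < det \<Sigma>" "prob_space (mvn 0 \<Sigma>)"
    unfolding \<Sigma>_def by (rule gram_covariance[OF assms(1)])+
  have Z_push: "distr (mvn 0 \<Sigma>) borel R = gaussian_copula_law \<Omega> F p"
    unfolding assms(20)
    by (rule distr_mvn_copula[OF \<Sigma>(1,2) s _ assms(8,9,10,11)]) (simp add: assms(7) \<Sigma>_def)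
  have Y_eq: "AE \<omega> in P. Y \<omega> = R (Z \<omega>)"
  proof -
    \<comment> \<open>The exceptional inputs are those whose level is attained by \<open>F\<close>
      at a rational. They inherit countability from the rationals because
      \<open>\<lambda>t. \<Phi>(s t)\<close> is injective.\<close>
    define N where "N = {t. std_normal_cdf (s * t) \<in> F ` \<rat>}"
    have "countable ((\<lambda>t. std_normal_cdf (s * t)) ` N)"
      by (rule countable_subset[of _ "F ` \<rat>"]) (auto simp: N_def intro: countable_rat)
    moreover have "inj_on (\<lambda>t. std_normal_cdf (s * t)) N"
      using s by (auto intro!: inj_onI simp: std_normal_cdf_eq_iff)
    ultimately have "countable N" by (rule countable_image_inj_on)
    then have "AE z in distr P borel Z. \<forall>i. z $ i \<notin> N"
      unfolding Z_law by (rule AE_mvn_component_notin_countable)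
    then have "AE \<omega> in P. \<forall>i. Z \<omega> $ i \<notin> N"
      by (rule AE_distrD[OF assms(15)])
    with assms(19) show ?thesis
    proof eventually_elim
      case (elim \<omega>)
      have "Y \<omega> $ i = r (Z \<omega> $ i)" for i
        unfolding r_def F
        by (rule eq_quantile[OF D cont std_normal_cdf_bounds]) (use elim in \<open>auto simp: F N_def\<close>)
      then show ?case by (simp add: R vec_eq_iff)
    qed
  qed
  have Y_law: "distr P borel Y = gaussian_copula_law \<Omega> F p"
  proof -
    have "distr P borel Y = distr P borel (\<lambda>\<omega>. R (Z \<omega>))"
      by (rule distr_cong_AE[OF refl refl Y_eq assms(16)]) (rule measurable_compose[OF assms(15) R_meas])
    also have "\<dots> = distr (distr P borel Z) borel R"
      by (subst distr_distr[OF R_meas assms(15)]) (simp add: comp_def)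
    finally show ?thesis by (simp add: Z_law Z_push)
  qed
  have jac: "R differentiable (at z) \<and>
      det (jacobian R (at z)) = (\<Prod>i\<in>UNIV. s * std_normal_density (s * z $ i) / p (R z $ i))"
    if "\<forall>i. p (R z $ i) > 0" for z
  proof -
    have "(r has_real_derivative s * std_normal_density (s * z $ i) / p (R z $ i)) (at (z $ i))" for i
    proof -
      have Ri: "R z $ i = quantile (cdf D) (std_normal_cdf (s * z $ i))" by (simp add: R r_def F)
      have "p (R z $ i) > 0" using that by blast
      then show ?thesis
        unfolding r_def[abs_def] F
        by (intro quantile_std_normal_has_real_derivative D cont)
           (use assms(12)[of "R z $ i"] in \<open>simp_all add: Ri F\<close>)
    qed
    from det_jacobian_componentwise[OF this] show ?thesis unfolding R by simp
  qed
  have ot: "optimal_transport_map (distr P borel Z) (gaussian_copula_law \<Omega> F p) R"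
    unfolding Z_law unfolding R
    by (rule optimal_transport_map_componentwise_mono[OF \<Sigma>(3) _ mono])
       (use Z_push R_meas in \<open>simp_all add: transport_map_def mvn_def flip: R\<close>)
  have cond: "conditional_law P M Y (\<lambda>\<mu>. distr (mvn (E *v \<mu>) (mat 1)) borel R)"
    by (rule conditional_law_map[OF assms(18) R_meas assms(14,15,16) Y_eq])
  have "AE \<mu> in distr P borel M. transport_map (mvn (E *v \<mu>) (mat 1)) (\<kappa> \<mu>) R"
    if "conditional_law P M Y \<kappa>" for \<kappa>
    using conditional_law_unique[OF assms(13,14) that cond]
    by eventually_elim (simp add: transport_map_def R_meas)
  with jac Y_law ot cond show ?thesis by blast
qed

end
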